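(* Let $G$ be an abelian group, let $\mathcal{D}$ be a real algebra isomorphic to $M_n(\mathbb{R})$, and let $\Gamma$ be a division $G$-grading on $\mathcal{D}$ whose nonzero homogeneous components have dimension $1$. Thus $n=2^m$, the support $T$ is isomorphic to $\mathbb{Z}_2^{2m}$, and $\Gamma$ determines the alternating bicharacter $\beta:T\times T\to\{\pm1\}$ of type I and the quadratic form $\mu:T\to\{\pm1\}$ defined in the context, with $\beta_\mu=\beta$ and $\operatorname{Arf}(\mu)=+1$. Then the equation $\varphi(X_t)=\eta(t)X_t$ for all $t\in T$, $X_t\in\mathcal{D}_t$, gives a bijective correspondence between the involutions $\varphi$ of the graded algebra $\mathcal{D}$ and the quadratic forms $\eta:T\to\{\pm1\}$ with $\beta_\eta=\beta$. The pair $(\Gamma,\varphi)$ is determined up to isomorphism by the pair of quadratic forms $(\mu,\eta)$ on $T$; in particular the $2^{2m}$ involutions of the graded algebra $\mathcal{D}$ are pairwise non-isomorphic. Two such pairs $(\Gamma,\varphi)$ and $(\Gamma,\varphi')$, with corresponding quadratic forms $\eta$ and $\eta'$, are equivalent if and only if $\eta$ and $\eta'$ belong to the same one of the following three sets: (1) $\eta=\mu$; (2) $\operatorname{Arf}(\eta)=+1$ but $\eta\neq\mu$; (3) $\operatorname{Arf}(\eta)=-1$.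
   Context: A grading on an algebra $\mathcal{D}$ by a group $G$ is a vector space decomposition $\mathcal{D}=\bigoplus_{g\in G}\mathcal{D}_g$ with $\mathcal{D}_g\mathcal{D}_h\subseteq\mathcal{D}_{gh}$. The support is the set of $g$ with $\mathcal{D}_g\neq0$. It is a division grading if every nonzero homogeneous element is invertible. An involution of the graded algebra $\mathcal{D}$ is a bijective $\mathbb{R}$-linear map $\varphi:\mathcal{D}\to\mathcal{D}$ with $\varphi(XY)=\varphi(Y)\varphi(X)$, $\varphi(\varphi(X))=X$ and $\varphi(\mathcal{D}_g)\subseteq\mathcal{D}_g$ for all $g$. If $\varphi,\varphi'$ are involutions on graded algebras $\mathcal{D},\mathcal{D}'$ with gradings $\Gamma,\Gamma'$, the pairs $(\Gamma,\varphi)$, $(\Gamma',\varphi')$ are isomorphic (respectively equivalent) if there is an algebra isomorphism $\psi:\mathcal{D}\to\mathcal{D}'$ with $\varphi'\psi=\psi\varphi$ and $\psi(\mathcal{D}_g)=\mathcal{D}'_g$ for all $g$ (respectively, for each $g$ in the support, $\psi(\mathcal{D}_g)=\mathcal{D}'_h$ for some $h$). An alternating bicharacter on $T$ is a map $\beta:T\times T\to\mathbb{R}\setminus\{0\}$ multiplicative in each variable with $\beta(u,u)=1$. It is of type I if $\{t\mid\beta(u,t)=1\ \forall u\in T\}=\{e\}$. A quadratic form on $T$ is a map $\mu:T\to\{\pm1\}$ such that its polarization $\beta_\mu(u,v)=\mu(uv)\mu(u)^{-1}\mu(v)^{-1}$ is an alternating bicharacter. $\operatorname{Arf}(\mu)$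 is $+1$, $-1$ or $0$ according to whether $\mu$ takes the value $+1$ more often than, less often than, or as often as $-1$. For $\Gamma$ as in the claim, $\beta$ and $\mu$ are defined by $X_uX_v=\beta(u,v)X_vX_u$ for $0\ne X_u\in\mathcal{D}_u$, $0\ne X_v\in\mathcal{D}_v$, and by requiring $X_t^2$ to be a positive real multiple of $\mu(t)1$ for $0\neq X_t\in\mathcal{D}_t$. *)

theory Defs
  imports "HOL-Analysis.Analysis" "HOL-Algebra.Product_Groups" "HOL-Algebra.Elementary_Groups"
begin

definition algebra_iso :: "('a::real_algebra_1 \<Rightarrow> 'b::real_algebra_1) \<Rightarrow> bool" where
  "algebra_iso \<psi> \<longleftrightarrow>
     linear \<psi> \<and> bij \<psi> \<and> (\<forall>x y. \<psi> (x * y) = \<psi> x * \<psi> y) \<and> \<psi> 1 = 1"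

text \<open>The ring structure of \<open>real^'n^'n\<close> given by the type classes is the componentwise one,
  so isomorphisms onto the full matrix algebra are phrased with the matrix product \<open>**\<close>.\<close>

definition matrix_algebra_iso :: "('a::real_algebra_1 \<Rightarrow> real^'n^'n) \<Rightarrow> bool" where
  "matrix_algebra_iso f \<longleftrightarrow>
     linear f \<and> bij f \<and> (\<forall>x y. f (x * y) = f x ** f y) \<and> f 1 = mat 1"

text \<open>A grading is a family of homogeneous components; its values outside \<open>carrier G\<close> are
  irrelevant everywhere below. The second conjunct is the direct sum decomposition: every element
  has exactly one expansion as a finite sum of homogeneous elements.\<close>

definition grading ::
  "('g, 'c) monoid_scheme \<Rightarrow> ('g \<Rightarrow> 'a::real_algebra_1 set) \<Rightarrow> bool" where
  "grading G D \<longleftrightarrow>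
     (\<forall>g\<in>carrier G. subspace (D g)) \<and>
     (\<forall>x. \<exists>!c. (\<forall>g\<in>carrier G. c g \<in> D g) \<and> (\<forall>g. g \<notin> carrier G \<longrightarrow> c g = 0) \<and>
               finite {g. c g \<noteq> 0} \<and> x = (\<Sum>g\<in>{g. c g \<noteq> 0}. c g)) \<and>
     (\<forall>g\<in>carrier G. \<forall>h\<in>carrier G. \<forall>x\<in>D g. \<forall>y\<in>D h. x * y \<in> D (g \<otimes>\<^bsub>G\<^esub> h))"

definition support ::
  "('g, 'c) monoid_scheme \<Rightarrow> ('g \<Rightarrow> 'a::real_algebra_1 set) \<Rightarrow> 'g set" where
  "support G D = {g \<in> carrier G. D g \<noteq> {0}}"

definition division_grading ::
  "('g, 'c) monoid_scheme \<Rightarrow> ('g \<Rightarrow> 'a::real_algebra_1 set) \<Rightarrow> bool" where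
  "division_grading G D \<longleftrightarrow>
     grading G D \<and>
     (\<forall>g\<in>carrier G. \<forall>x\<in>D g. x \<noteq> 0 \<longrightarrow> (\<exists>y. x * y = 1 \<and> y * x = 1))"

definition one_dim_division_grading ::
  "('g, 'c) monoid_scheme \<Rightarrow> ('g \<Rightarrow> 'a::real_algebra_1 set) \<Rightarrow> bool" where
  "one_dim_division_grading G D \<longleftrightarrow>
     division_grading G D \<and> (\<forall>t\<in>support G D. dim (D t) = 1)"

definition graded_involution ::
  "('g, 'c) monoid_scheme \<Rightarrow> ('g \<Rightarrow> 'a::real_algebra_1 set) \<Rightarrow> ('a \<Rightarrow> 'a) \<Rightarrow> bool" where
  "graded_involution G D \<phi> \<longleftrightarrow>
     linear \<phi> \<and> bij \<phi> \<and> (\<forall>x y. \<phi> (x * y) = \<phi> y * \<phi> x) \<and> (\<forall>x. \<phi> (\<phi> x) = x) \<and>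
     (\<forall>g\<in>carrier G. \<phi> ` D g \<subseteq> D g)"

definition isomorphic_pairs ::
  "('g, 'c) monoid_scheme \<Rightarrow>
   ('g \<Rightarrow> 'a::real_algebra_1 set) \<Rightarrow> ('a \<Rightarrow> 'a) \<Rightarrow>
   ('g \<Rightarrow> 'b::real_algebra_1 set) \<Rightarrow> ('b \<Rightarrow> 'b) \<Rightarrow> bool" where
  "isomorphic_pairs G D \<phi> D' \<phi>' \<longleftrightarrow>
     (\<exists>\<psi>. algebra_iso \<psi> \<and> \<phi>' \<circ> \<psi> = \<psi> \<circ> \<phi> \<and> (\<forall>g\<in>carrier G. \<psi> ` D g = D' g))"

definition equivalent_pairs ::
  "('g, 'c) monoid_scheme \<Rightarrow> ('g \<Rightarrow> 'a::real_algebra_1 set) \<Rightarrow> ('a \<Rightarrow> 'a) \<Rightarrow>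
   ('h, 'd) monoid_scheme \<Rightarrow> ('h \<Rightarrow> 'b::real_algebra_1 set) \<Rightarrow> ('b \<Rightarrow> 'b) \<Rightarrow> bool" where
  "equivalent_pairs G D \<phi> G' D' \<phi>' \<longleftrightarrow>
     (\<exists>\<psi>. algebra_iso \<psi> \<and> \<phi>' \<circ> \<psi> = \<psi> \<circ> \<phi> \<and>
          (\<forall>g\<in>support G D. \<exists>h\<in>carrier G'. \<psi> ` D g = D' h))"

definition alternating_bicharacter ::
  "('g, 'c) monoid_scheme \<Rightarrow> ('g \<Rightarrow> 'g \<Rightarrow> real) \<Rightarrow> bool" where
  "alternating_bicharacter T \<beta> \<longleftrightarrow>
     (\<forall>u\<in>carrier T. \<forall>v\<in>carrier T. \<beta> u v \<noteq> 0) \<and>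
     (\<forall>u\<in>carrier T. \<forall>v\<in>carrier T. \<forall>w\<in>carrier T. \<beta> (u \<otimes>\<^bsub>T\<^esub> v) w = \<beta> u w * \<beta> v w) \<and>
     (\<forall>u\<in>carrier T. \<forall>v\<in>carrier T. \<forall>w\<in>carrier T. \<beta> u (v \<otimes>\<^bsub>T\<^esub> w) = \<beta> u v * \<beta> u w) \<and>
     (\<forall>u\<in>carrier T. \<beta> u u = 1)"

definition type_I :: "('g, 'c) monoid_scheme \<Rightarrow> ('g \<Rightarrow> 'g \<Rightarrow> real) \<Rightarrow> bool" where
  "type_I T \<beta> \<longleftrightarrow> {t \<in> carrier T. \<forall>u\<in>carrier T. \<beta> u t = 1} = {\<one>\<^bsub>T\<^esub>}"

definition polarization ::
  "('g, 'c) monoid_scheme \<Rightarrow> ('g \<Rightarrow> real) \<Rightarrow> 'g \<Rightarrow> 'g \<Rightarrow> real" where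
  "polarization T \<mu> u v = \<mu> (u \<otimes>\<^bsub>T\<^esub> v) * inverse (\<mu> u) * inverse (\<mu> v)"

text \<open>Maps on \<open>T\<close> are extensional, so that HOL equality of quadratic forms is equality
  as maps on \<open>T\<close>.\<close>

definition quadratic_form :: "('g, 'c) monoid_scheme \<Rightarrow> ('g \<Rightarrow> real) \<Rightarrow> bool" where
  "quadratic_form T \<mu> \<longleftrightarrow>
     \<mu> \<in> carrier T \<rightarrow>\<^sub>E {1, -1} \<and> alternating_bicharacter T (polarization T \<mu>)"

definition quadratic_forms_with_polarization ::
  "('g, 'c) monoid_scheme \<Rightarrow> ('g \<Rightarrow> 'g \<Rightarrow> real) \<Rightarrow> ('g \<Rightarrow> real) set" where
  "quadratic_forms_with_polarization T \<beta> =
     {\<eta>. quadratic_form T \<eta> \<and>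
         (\<forall>u\<in>carrier T. \<forall>v\<in>carrier T. polarization T \<eta> u v = \<beta> u v)}"

text \<open>Meaningful for finite \<open>T\<close> only.\<close>

definition Arf :: "('g, 'c) monoid_scheme \<Rightarrow> ('g \<Rightarrow> real) \<Rightarrow> int" where
  "Arf T \<mu> =
     (let p = card {t \<in> carrier T. \<mu> t = 1}; q = card {t \<in> carrier T. \<mu> t = -1}
      in if p > q then 1 else if p < q then -1 else 0)"

abbreviation support_group ::
  "('g, 'c) monoid_scheme \<Rightarrow> ('g \<Rightarrow> 'a::real_algebra_1 set) \<Rightarrow> ('g, 'c) monoid_scheme" where
  "support_group G D \<equiv> G\<lparr>carrier := support G D\<rparr>"

definition grading_bichar :: "('g \<Rightarrow> 'a::real_algebra_1 set) \<Rightarrow> 'g \<Rightarrow> 'g \<Rightarrow> real" where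
  "grading_bichar D u v =
     (THE b. \<forall>x\<in>D u - {0}. \<forall>y\<in>D v - {0}. x * y = b *\<^sub>R (y * x))"

definition grading_quad ::
  "('g, 'c) monoid_scheme \<Rightarrow> ('g \<Rightarrow> 'a::real_algebra_1 set) \<Rightarrow> 'g \<Rightarrow> real" where
  "grading_quad G D =
     (\<lambda>t\<in>support G D. THE s. s \<in> {1, -1} \<and>
        (\<forall>x\<in>D t - {0}. \<exists>r>0. x * x = (r * s) *\<^sub>R 1))"

definition acts_by ::
  "('g, 'c) monoid_scheme \<Rightarrow> ('g \<Rightarrow> 'a::real_algebra_1 set) \<Rightarrow> ('a \<Rightarrow> 'a) \<Rightarrow> ('g \<Rightarrow> real) \<Rightarrow> bool" where
  "acts_by G D \<phi> \<eta> \<longleftrightarrow> (\<forall>t\<in>support G D. \<forall>x\<in>D t. \<phi> x = \<eta> t *\<^sub>R x)"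

end

theory Submission
  imports Defs
begin

text \<open>Quadratic forms with polarization \<open>\<beta>\<close> are the twists \<open>\<mu> \<cdot> \<beta> c\<close> with \<open>c\<close> in \<open>T\<close>, and the sum of the
  values of such a twist is \<open>\<mu> c\<close> times that of \<open>\<mu>\<close>. Hence the three classes are the orbits of the
  isometry group of \<open>\<mu>\<close>: they correspond to \<open>c = 1\<close>, to \<open>\<mu> c = 1\<close> with \<open>c \<noteq> 1\<close>, and to
  \<open>\<mu> c = -1\<close>; transitivity follows from transvections and Siegel maps. Every isometry of \<open>\<mu>\<close> is
  induced by a graded isomorphism, because homogeneous bases can be chosen, one generator of \<open>T\<close> at a
  time, so that both sides have the same structure constants. Finally \<open>Arf \<mu> = 1\<close> because the trace
  form of \<open>M\<^sub>n(\<real>)\<close> is nonnegative on the symmetric matrices, which fill more than half of the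
  space.\<close>

section \<open>Elementary abelian 2-groups\<close>

text \<open>The values of \<open>\<beta>\<close> and the exponent of \<open>T\<close> must be
  extracted from the algebra before quadratic forms can be discussed: real scalars of finite order
  are signs, and the center of a matrix algebra consists of scalars, so that \<open>\<beta>\<close>
  is nondegenerate and every square in \<open>T\<close> is trivial.

  The obstacle to lifting an isometry is the sign ambiguity of normalized homogeneous elements: a
  product of two of them is a sign times a third, and this sign depends on the choices, while only
  \<open>\<beta>\<close> and \<open>\<mu>\<close> are intrinsic. Building the elements along a chain
  of subgroups makes all these signs functions of \<open>\<beta>\<close>, \<open>\<mu>\<close> and
  the chain.

  Parametrizing \<open>\<eta>\<close> by an element \<open>c\<close> turns a question on pairs of
  forms into one on single elements, so that only the one-vector case of Witt's theorem is needed
  and explicit maps suffice. The sign of the sum of \<open>\<mu>\<close> matters because it decides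
  which value of \<open>\<mu> c\<close> means Arf invariant +1.\<close>

lemma sign_mult_self: "x \<in> {1, -1::real} \<Longrightarrow> x * x = 1"
  by auto

locale elementary_2_group = comm_group T for T :: "('g, 'c) monoid_scheme" (structure) +
  assumes finite_carrier: "finite (carrier T)"
    and square_one: "t \<in> carrier T \<Longrightarrow> t \<otimes> t = \<one>"
begin

lemma mult_cancel_square [simp]:
  assumes "u \<in> carrier T" "t \<in> carrier T"
  shows "u \<otimes> (u \<otimes> t) = t"
  using assms by (simp add: square_one flip: m_assoc)

text \<open>Two cosets suffice because \<open>a\<close> is its own inverse: the product of two
  elements of the coset of \<open>a\<close> falls back into \<open>H\<close>.\<close>

lemma subgroup_extend:
  assumes H: "subgroup H T" and a: "a \<in> carrier T"
  shows "subgroup (H \<union> (\<lambda>h. h \<otimes> a) ` H) T"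
proof -
  interpret H: subgroup H T by fact
  have inv: "inv x = x" if "x \<in> carrier T" for x
    using that by (simp add: inv_equality square_one)
  have *: "(h \<otimes> a) \<otimes> (k \<otimes> a) = h \<otimes> k" if "h \<in> H" "k \<in> H" for h k
    using that a by (simp add: m_ac)
  have **: "h \<otimes> a \<otimes> k = (h \<otimes> k) \<otimes> a" if "h \<in> H" "k \<in> H" for h k
    using that a by (simp add: m_ac)
  show ?thesis
  proof
    show "H \<union> (\<lambda>h. h \<otimes> a) ` H \<subseteq> carrier T"
      using a by auto
    show "x \<otimes> y \<in> H \<union> (\<lambda>h. h \<otimes> a) ` H"
      if "x \<in> H \<union> (\<lambda>h. h \<otimes> a) ` H" "y \<in> H \<union> (\<lambda>h. h \<otimes> a) ` H" for x y
      using that a * ** by (auto simp: m_assoc[symmetric])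
    show "inv x \<in> H \<union> (\<lambda>h. h \<otimes> a) ` H" if "x \<in> H \<union> (\<lambda>h. h \<otimes> a) ` H" for x
      using that a by (auto simp: inv)
  qed auto
qed

text \<open>This stands in for choosing a basis of \<open>T\<close> over the field with two
  elements: a construction that survives adjoining one generator reaches all of \<open>T\<close>. A
  subgroup of largest cardinality among those with \<open>P\<close> must be everything, as it could
  otherwise be enlarged.\<close>

lemma subgroup_induct [consumes 0, case_names one extend]:
  assumes one: "P {\<one>}"
    and ext: "\<And>H a. \<lbrakk>subgroup H T; a \<in> carrier T; a \<notin> H; P H\<rbrakk> \<Longrightarrow> P (H \<union> (\<lambda>h. h \<otimes> a) ` H)"
  shows "P (carrier T)"
proof -
  define S where "S = {H. subgroup H T \<and> P H}"
  have sub: "K \<subseteq> carrier T" if "K \<in> S" for K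
    using that subgroup.subset[of K T] by (simp add: S_def)
  have "{\<one>} \<in> S"
    using one by (simp add: S_def triv_subgroup)
  moreover have "\<forall>K. K \<in> S \<longrightarrow> card K < Suc (card (carrier T))"
    using sub card_mono[OF finite_carrier] by (simp add: less_Suc_eq_le)
  ultimately obtain H where H: "H \<in> S" and max: "\<forall>K. K \<in> S \<longrightarrow> card K \<le> card H"
    using ex_has_greatest_nat[of "\<lambda>K. K \<in> S" "{\<one>}" card "Suc (card (carrier T))"] by auto
  have "carrier T \<subseteq> H"
  proof
    fix a assume a: "a \<in> carrier T"
    show "a \<in> H"
    proof (rule ccontr)
      assume "a \<notin> H"
      let ?K = "H \<union> (\<lambda>h. h \<otimes> a) ` H"
      have H': "subgroup H T" "P H"
        using H by (simp_all add: S_def)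
      have "?K \<in> S"
        unfolding S_def using ext[OF H'(1) a \<open>a \<notin> H\<close> H'(2)] subgroup_extend[OF H'(1) a] by simp
      then have "card ?K \<le> card H"
        using max by simp
      moreover have "a \<in> ?K"
        using a subgroup.one_closed[OF H'(1)] by (intro UnI2 image_eqI[of _ _ \<one>]) simp_all
      moreover have "finite ?K"
        using sub[OF H] finite_carrier finite_subset by blast
      ultimately show False
        using \<open>a \<notin> H\<close> psubset_card_mono[of ?K H] by (simp add: psubset_eq) blast
    qed
  qed
  then have "H = carrier T"
    using sub[OF H] by simp
  then show ?thesis
    using H by (simp add: S_def)
qed

text \<open>Keeps the two cosets of an extension apart, so that data may be prescribed on each of
  them independently.\<close>

lemma subgroup_extend_inj:
  assumes H: "subgroup H T" and a: "a \<in> carrier T" "a \<notin> H"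
    and hk: "h \<in> H" "k \<in> H"
  shows "h \<otimes> a \<noteq> k"
proof
  interpret H: subgroup H T by fact
  assume "h \<otimes> a = k"
  then have "a = h \<otimes> k"
    using mult_cancel_square[of h a] hk a H.mem_carrier by metis
  then show False
    using hk a by (metis H.m_closed)
qed

text \<open>The vectors are extensional functions into \<open>{0..<2}\<close> with addition mod 2,
  which is what a \<open>product_group\<close> of copies of \<open>integer_mod_group 2\<close>
  unfolds to. Phrased for a target set instead of a group record, the claim fits
  \<open>subgroup_induct\<close>.\<close>

lemma bit_vectors_bij:
  "\<exists>(k::nat) h. (\<forall>v \<in> {..<k} \<rightarrow>\<^sub>E {0..<2::int}. \<forall>w \<in> {..<k} \<rightarrow>\<^sub>E {0..<2}.
      h (\<lambda>i\<in>{..<k}. (v i + w i) mod 2) = h v \<otimes> h w) \<and>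
     bij_betw h ({..<k} \<rightarrow>\<^sub>E {0..<2}) (carrier T)"
proof (induction rule: subgroup_induct)
  case one
  have "bij_betw (\<lambda>v::nat \<Rightarrow> int. \<one>) ({..<0} \<rightarrow>\<^sub>E {0..<2}) {\<one>}"
    by (simp add: bij_betw_def)
  then show ?case
    by (intro exI[of _ "0::nat"] exI[of _ "\<lambda>v. \<one>"] conjI) simp_all
next
  case (extend H a)
  let ?V = "\<lambda>k. {..<k::nat} \<rightarrow>\<^sub>E {0..<2::int}"
  from extend.IH obtain k :: nat and h where
    h: "\<forall>v\<in>?V k. \<forall>w\<in>?V k. h (\<lambda>i\<in>{..<k}. (v i + w i) mod 2) = h v \<otimes> h w"
    and bij: "bij_betw h (?V k) H"
    by (elim exE conjE)
  interpret H: subgroup H T by fact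
  \<comment> \<open>Coordinate \<open>k\<close> is the exponent of the new generator
    \<open>a\<close>; the first \<open>k\<close> coordinates describe the factor in
    \<open>H\<close>.\<close>
  define g where "g v = h (restrict v {..<k}) \<otimes> (if v k = 0 then \<one> else a)" for v :: "nat \<Rightarrow> int"
  have res: "restrict v {..<k} \<in> ?V k" if "v \<in> ?V (Suc k)" for v
    using that by fastforce
  have hV: "h v \<in> H" if "v \<in> ?V k" for v
    using bij_betwE[OF bij] that by blast
  have hVc: "h v \<in> carrier T" if "v \<in> ?V k" for v
    using hV[OF that] by simp
  have bit: "v k = 0 \<or> v k = 1" if "v \<in> ?V (Suc k)" for v
    using PiE_mem[OF that, of k] by auto
  have "\<forall>v\<in>?V (Suc k). \<forall>w\<in>?V (Suc k). g (\<lambda>i\<in>{..<Suc k}. (v i + w i) mod 2) = g v \<otimes> g w"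
  proof (intro ballI)
    fix v w assume v: "v \<in> ?V (Suc k)" and w: "w \<in> ?V (Suc k)"
    have "restrict (\<lambda>i\<in>{..<Suc k}. (v i + w i) mod 2) {..<k}
        = (\<lambda>i\<in>{..<k}. (restrict v {..<k} i + restrict w {..<k} i) mod 2)"
      by auto
    then have "g (\<lambda>i\<in>{..<Suc k}. (v i + w i) mod 2) = h (restrict v {..<k}) \<otimes> h (restrict w {..<k})
        \<otimes> (if (v k + w k) mod 2 = 0 then \<one> else a)"
      unfolding g_def using h[rule_format, OF res[OF v] res[OF w]] by simp
    then show "g (\<lambda>i\<in>{..<Suc k}. (v i + w i) mod 2) = g v \<otimes> g w"
      unfolding g_def
      using bit[OF v] bit[OF w] hVc[OF res[OF v]] hVc[OF res[OF w]] \<open>a \<in> carrier T\<close>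
      by (elim disjE) (simp_all add: m_ac square_one)
  qed
  moreover have "inj_on g (?V (Suc k))"
  proof (rule inj_onI)
    fix v w assume v: "v \<in> ?V (Suc k)" and w: "w \<in> ?V (Suc k)" and eq: "g v = g w"
    note V = hV[OF res[OF v]] and W = hV[OF res[OF w]]
    \<comment> \<open>Different last bits would put the common value into both cosets.\<close>
    have bits: "v k = w k"
      using eq bit[OF v] bit[OF w] subgroup_extend_inj[OF extend.hyps V W]
        subgroup_extend_inj[OF extend.hyps W V] V W
      by (elim disjE) (simp_all add: g_def)
    then have "h (restrict v {..<k}) = h (restrict w {..<k})"
      using eq V W \<open>a \<in> carrier T\<close> by (simp add: g_def split: if_splits)
    then have "restrict v {..<k} = restrict w {..<k}"
      by (rule inj_onD[OF bij_betw_imp_inj_on[OF bij] _ res[OF v] res[OF w]])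
    then have "v i = w i" if "i < Suc k" for i
      using bits that by (metis lessThan_iff less_Suc_eq restrict_apply')
    then show "v = w"
      using v w by (intro PiE_ext) auto
  qed
  moreover have "g ` ?V (Suc k) = H \<union> (\<lambda>h. h \<otimes> a) ` H"
  proof
    show "g ` ?V (Suc k) \<subseteq> H \<union> (\<lambda>h. h \<otimes> a) ` H"
    proof (rule image_subsetI)
      fix v assume "v \<in> ?V (Suc k)"
      then have "h (restrict v {..<k}) \<in> H"
        by (rule hV[OF res])
      then show "g v \<in> H \<union> (\<lambda>h. h \<otimes> a) ` H"
        by (cases "v k = 0") (simp_all add: g_def)
    qed
    have *: "x \<otimes> (if b = 0 then \<one> else a) \<in> g ` ?V (Suc k)" if "x \<in> H" "b \<in> {0, 1}" for x and b :: int
    proof -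
      have "x \<in> h ` ?V k"
        using that(1) bij_betw_imp_surj_on[OF bij] by simp
      then obtain v where v: "x = h v" "v \<in> ?V k"
        by (rule imageE)
      have "restrict (v(k := b)) {..<k} = v"
        using v(2) by (intro ext) (simp add: PiE_iff extensional_def)
      moreover have "v(k := b) \<in> ?V (Suc k)"
        using v(2) that(2) by (auto simp: PiE_iff extensional_def less_Suc_eq)
      ultimately show ?thesis
        using v(1) by (intro image_eqI[of _ _ "v(k := b)"]) (simp_all add: g_def)
    qed
    show "H \<union> (\<lambda>h. h \<otimes> a) ` H \<subseteq> g ` ?V (Suc k)"
    proof
      fix x assume "x \<in> H \<union> (\<lambda>h. h \<otimes> a) ` H"
      then consider "x \<in> H" | y where "y \<in> H" "x = y \<otimes> a"
        by blast
      then show "x \<in> g ` ?V (Suc k)"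
      proof cases
        case 1
        then show ?thesis
          using *[of x 0] by simp
      next
        case (2 y)
        then show ?thesis
          using *[of y 1] by simp
      qed
    qed
  qed
  ultimately show ?case
    unfolding bij_betw_def by (intro exI[of _ "Suc k"] exI[of _ g] conjI)
qed

lemma card_carrier_power: "\<exists>k. card (carrier T) = 2 ^ k"
proof -
  obtain k :: nat and h where bij: "bij_betw h ({..<k} \<rightarrow>\<^sub>E {0..<2::int}) (carrier T)"
    using bit_vectors_bij by blast
  show ?thesis
    using bij_betw_same_card[OF bij] by (intro exI[of _ k]) (simp add: card_PiE)
qed

lemma iso_bit_vectors:
  assumes "card (carrier T) = 2 ^ k"
  shows "T \<cong> product_group {..<k} (\<lambda>_. integer_mod_group 2)"
proof -
  obtain l :: nat and h where h: "\<forall>v \<in> {..<l} \<rightarrow>\<^sub>E {0..<2::int}. \<forall>w \<in> {..<l} \<rightarrow>\<^sub>E {0..<2}.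
      h (\<lambda>i\<in>{..<l}. (v i + w i) mod 2) = h v \<otimes> h w"
    and bij: "bij_betw h ({..<l} \<rightarrow>\<^sub>E {0..<2}) (carrier T)"
    using bit_vectors_bij by (elim exE conjE)
  have "card ({..<l} \<rightarrow>\<^sub>E {0..<2::int}) = 2 ^ l"
    by (simp add: card_PiE)
  then have "l = k"
    using bij_betw_same_card[OF bij] assms by simp
  moreover have "h \<in> hom (product_group {..<l} (\<lambda>_. integer_mod_group 2)) T"
    using h bij_betwE[OF bij] by (intro homI) (simp_all add: carrier_integer_mod_group)
  ultimately have "product_group {..<k} (\<lambda>_. integer_mod_group 2) \<cong> T"
    using bij by (auto simp: is_iso_def iso_def carrier_integer_mod_group)
  then show ?thesis
    by (rule group.iso_sym[rotated]) simp
qed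

text \<open>Translation by \<open>s\<close> permutes the summands and at the same time multiplies
  the sum by \<open>\<xi> s\<close>.\<close>

lemma sum_character:
  fixes \<xi> :: "'g \<Rightarrow> real"
  assumes mult: "\<And>u v. \<lbrakk>u \<in> carrier T; v \<in> carrier T\<rbrakk> \<Longrightarrow> \<xi> (u \<otimes> v) = \<xi> u * \<xi> v"
    and s: "s \<in> carrier T" "\<xi> s \<noteq> 1"
  shows "(\<Sum>t\<in>carrier T. \<xi> t) = 0"
proof -
  have "(\<Sum>t\<in>carrier T. \<xi> t) = (\<Sum>t\<in>carrier T. \<xi> (s \<otimes> t))"
    using s by (intro sum.reindex_bij_witness[of _ "\<lambda>t. s \<otimes> t" "\<lambda>t. s \<otimes> t"]) auto
  also have "\<dots> = \<xi> s * (\<Sum>t\<in>carrier T. \<xi> t)"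
    using s by (simp add: mult sum_distrib_left)
  finally show ?thesis
    using s by simp
qed

end

section \<open>Quadratic forms\<close>

text \<open>The sum is the difference of the two cardinalities that \<open>Arf\<close> compares.
  Unlike the counts, it can be reindexed and factored.\<close>

lemma Arf_eq_sum:
  assumes fin: "finite (carrier T)" and sign: "\<And>t. t \<in> carrier T \<Longrightarrow> \<kappa> t \<in> {1, -1}"
  shows "Arf T \<kappa> = (if (\<Sum>t\<in>carrier T. \<kappa> t) > 0 then 1 else if (\<Sum>t\<in>carrier T. \<kappa> t) < 0 then -1 else 0)"
proof -
  let ?P = "{t \<in> carrier T. \<kappa> t = 1}" and ?N = "{t \<in> carrier T. \<kappa> t = -1}"
  have split: "carrier T = ?P \<union> ?N"
    using sign by blast
  have "(\<Sum>t\<in>carrier T. \<kappa> t) = (\<Sum>t\<in>?P \<union> ?N. \<kappa> t)"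
    by (rule arg_cong[OF split])
  also have "\<dots> = (\<Sum>t\<in>?P. \<kappa> t) + (\<Sum>t\<in>?N. \<kappa> t)"
    using fin by (intro sum.union_disjoint) auto
  also have "\<dots> = real (card ?P) - real (card ?N)"
    by simp
  finally have "(\<Sum>t\<in>carrier T. \<kappa> t) = real (card ?P) - real (card ?N)" .
  then show ?thesis
    unfolding Arf_def Let_def by simp
qed

text \<open>The laws are taken in the form in which signs are computed: \<open>quad_mult\<close> is
  the polarization identity without inverses, and symmetry supplies multiplicativity in the second
  variable. \<open>alternating_bicharacter\<close> and \<open>type_I\<close> are recovered
  below.\<close>

locale quadratic_space = elementary_2_group T for T :: "('g, 'c) monoid_scheme" (structure) +
  fixes \<beta> :: "'g \<Rightarrow> 'g \<Rightarrow> real" and \<mu> :: "'g \<Rightarrow> real"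
  assumes bichar_sign: "\<lbrakk>u \<in> carrier T; v \<in> carrier T\<rbrakk> \<Longrightarrow> \<beta> u v \<in> {1, -1}"
    and bichar_mult_left:
      "\<lbrakk>u \<in> carrier T; v \<in> carrier T; w \<in> carrier T\<rbrakk> \<Longrightarrow> \<beta> (u \<otimes> v) w = \<beta> u w * \<beta> v w"
    and bichar_sym: "\<lbrakk>u \<in> carrier T; v \<in> carrier T\<rbrakk> \<Longrightarrow> \<beta> u v = \<beta> v u"
    and bichar_diag: "u \<in> carrier T \<Longrightarrow> \<beta> u u = 1"
    and nondegenerate: "\<lbrakk>t \<in> carrier T; \<And>u. u \<in> carrier T \<Longrightarrow> \<beta> u t = 1\<rbrakk> \<Longrightarrow> t = \<one>"
    and quad_sign: "t \<in> carrier T \<Longrightarrow> \<mu> t \<in> {1, -1}"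
    and quad_mult:
      "\<lbrakk>u \<in> carrier T; v \<in> carrier T\<rbrakk> \<Longrightarrow> \<mu> (u \<otimes> v) = \<mu> u * \<mu> v * \<beta> u v"
begin

lemma bichar_mult_right:
  "\<lbrakk>u \<in> carrier T; v \<in> carrier T; w \<in> carrier T\<rbrakk> \<Longrightarrow> \<beta> u (v \<otimes> w) = \<beta> u v * \<beta> u w"
  by (simp add: bichar_sym[of u] bichar_mult_left)

lemma bichar_square: "\<lbrakk>u \<in> carrier T; v \<in> carrier T\<rbrakk> \<Longrightarrow> \<beta> u v * \<beta> u v = 1"
  by (rule sign_mult_self[OF bichar_sign])

lemma quad_square: "t \<in> carrier T \<Longrightarrow> \<mu> t * \<mu> t = 1"
  by (rule sign_mult_self[OF quad_sign])

lemma bichar_one_left: "u \<in> carrier T \<Longrightarrow> \<beta> \<one> u = 1"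
  using bichar_mult_left[of u u u] by (simp add: square_one bichar_diag)

lemma bichar_one_right: "u \<in> carrier T \<Longrightarrow> \<beta> u \<one> = 1"
  by (simp add: bichar_sym[of u] bichar_one_left)

lemma quad_one: "\<mu> \<one> = 1"
  using quad_mult[of \<one> \<one>] quad_square[of \<one>] by (simp add: bichar_one_left)

lemma bichar_from_quad:
  "\<lbrakk>u \<in> carrier T; v \<in> carrier T\<rbrakk> \<Longrightarrow> \<beta> u v = \<mu> (u \<otimes> v) * \<mu> u * \<mu> v"
  using quad_sign[of u] quad_sign[of v] by (auto simp: quad_mult)

text \<open>In exponent two \<open>c \<otimes> d\<close> is the quotient of \<open>c\<close> and
  \<open>d\<close>, and it lies in the radical.\<close>

lemma bichar_unique:
  assumes "c \<in> carrier T" "d \<in> carrier T" "\<And>t. t \<in> carrier T \<Longrightarrow> \<beta> c t = \<beta> d t"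
  shows "c = d"
proof -
  have "c \<otimes> d = \<one>"
    using assms by (intro nondegenerate) (simp_all add: bichar_mult_right bichar_sym[of _ c] bichar_sym[of _ d] bichar_square)
  then show ?thesis
    using assms by (metis mult_cancel_square r_one)
qed

lemma exists_anticommuting:
  assumes "c \<in> carrier T" "c \<noteq> \<one>"
  obtains w where "w \<in> carrier T" "\<beta> c w = -1"
proof -
  obtain w where "w \<in> carrier T" "\<beta> w c \<noteq> 1"
    using nondegenerate assms by blast
  then show ?thesis
    using that bichar_sign[of w c] assms by (auto simp: bichar_sym[of c])
qed

text \<open>A group is not the union of two proper subgroups, here the kernels of
  \<open>\<beta> c\<close> and \<open>\<beta> d\<close>: if neither \<open>v\<close> nor
  \<open>w\<close> serves for both, then \<open>v \<otimes> w\<close> does.\<close>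

lemma exists_anticommuting2:
  assumes c: "c \<in> carrier T" "c \<noteq> \<one>" and d: "d \<in> carrier T" "d \<noteq> \<one>"
  obtains w where "w \<in> carrier T" "\<beta> c w = -1" "\<beta> d w = -1"
proof -
  obtain v w where v: "v \<in> carrier T" "\<beta> c v = -1" and w: "w \<in> carrier T" "\<beta> d w = -1"
    using exists_anticommuting c d by metis
  have "\<beta> c w = -1 \<or> \<beta> d v = -1 \<or> (\<beta> c (v \<otimes> w) = -1 \<and> \<beta> d (v \<otimes> w) = -1)"
    using c d v w bichar_sign[of c w] bichar_sign[of d v] by (auto simp: bichar_mult_right)
  then show ?thesis
    using that v w by (meson m_closed)
qed

lemma sum_bichar:
  assumes "t \<in> carrier T"
  shows "(\<Sum>c\<in>carrier T. \<beta> c t) = (if t = \<one> then real (card (carrier T)) else 0)"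
proof (cases "t = \<one>")
  case True
  then show ?thesis
    by (simp add: bichar_one_right)
next
  case False
  then obtain s where "s \<in> carrier T" "\<beta> t s = -1"
    using exists_anticommuting assms by blast
  then show ?thesis
    using sum_character[of "\<lambda>c. \<beta> c t" s] assms False bichar_mult_left
    by (simp add: bichar_sym[of s])
qed

text \<open>Fourier inversion at \<open>\<one>\<close>: the coefficients of \<open>\<xi>\<close>
  against all \<open>\<beta> c\<close> add up to the order of \<open>T\<close>, so one of them is
  nonzero. For that \<open>c\<close> the character \<open>\<xi> t * \<beta> c t\<close> has nonzero
  sum and is therefore trivial.\<close>

lemma character_representable:
  assumes mult: "\<And>u v. \<lbrakk>u \<in> carrier T; v \<in> carrier T\<rbrakk> \<Longrightarrow> \<xi> (u \<otimes> v) = \<xi> u * \<xi> v"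
    and sign: "\<And>t. t \<in> carrier T \<Longrightarrow> \<xi> t \<in> {1, -1::real}"
  obtains c where "c \<in> carrier T" "\<And>t. t \<in> carrier T \<Longrightarrow> \<xi> t = \<beta> c t"
proof -
  have one: "\<xi> \<one> = 1"
    using mult[of \<one> \<one>] sign[of \<one>] by auto
  have "(\<Sum>c\<in>carrier T. \<Sum>t\<in>carrier T. \<xi> t * \<beta> c t) = (\<Sum>t\<in>carrier T. \<xi> t * (\<Sum>c\<in>carrier T. \<beta> c t))"
    unfolding sum_distrib_left by (rule sum.swap)
  also have "\<dots> = (\<Sum>t\<in>carrier T. if t = \<one> then real (card (carrier T)) else 0)"
    by (rule sum.cong) (auto simp: sum_bichar one)
  also have "\<dots> = real (card (carrier T))"
    by (simp add: finite_carrier)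
  also have "\<dots> \<noteq> 0"
    using finite_carrier by (auto simp: card_eq_0_iff)
  finally obtain c where c: "c \<in> carrier T" "(\<Sum>t\<in>carrier T. \<xi> t * \<beta> c t) \<noteq> 0"
    by (meson sum.neutral)
  have "\<xi> t * \<beta> c t = 1" if "t \<in> carrier T" for t
    using sum_character[of "\<lambda>t. \<xi> t * \<beta> c t" t] c that
    by (auto simp: mult bichar_mult_right)
  then have "\<xi> t = \<beta> c t" if "t \<in> carrier T" for t
    using that sign[OF that] bichar_sign[OF c(1) that] by fastforce
  then show ?thesis
    using that c by blast
qed

text \<open>Completing the square: up to the factor \<open>\<mu> c\<close>, the twisted summand at
  \<open>t\<close> is the value of \<open>\<mu>\<close> at \<open>c \<otimes> t\<close>.\<close>

lemma sum_quad_twist: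
  assumes c: "c \<in> carrier T"
  shows "(\<Sum>t\<in>carrier T. \<mu> t * \<beta> c t) = \<mu> c * (\<Sum>t\<in>carrier T. \<mu> t)"
proof -
  have "(\<Sum>t\<in>carrier T. \<mu> t) = (\<Sum>t\<in>carrier T. \<mu> (c \<otimes> t))"
    using c by (intro sum.reindex_bij_witness[of _ "\<lambda>t. c \<otimes> t" "\<lambda>t. c \<otimes> t"]) auto
  also have "\<dots> = \<mu> c * (\<Sum>t\<in>carrier T. \<mu> t * \<beta> c t)"
    using c by (simp add: quad_mult sum_distrib_left mult_ac)
  finally have "\<mu> c * (\<Sum>t\<in>carrier T. \<mu> t) = (\<mu> c * \<mu> c) * (\<Sum>t\<in>carrier T. \<mu> t * \<beta> c t)"
    by simp
  then show ?thesis
    using c by (simp add: quad_square)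
qed

section \<open>Isometries of \<open>\<mu>\<close> and their transitivity on nontrivial
  elements\<close>

definition isometry :: "('g \<Rightarrow> 'g) \<Rightarrow> bool" where
  "isometry \<alpha> \<longleftrightarrow> \<alpha> \<in> hom T T \<and> bij_betw \<alpha> (carrier T) (carrier T) \<and> (\<forall>t\<in>carrier T. \<mu> (\<alpha> t) = \<mu> t)"

text \<open>\<open>\<mu>\<close> determines \<open>\<beta>\<close>, so such a map preserves
  \<open>\<beta>\<close>; nondegeneracy makes it injective, and finiteness bijective.\<close>

lemma isometryI:
  assumes hom: "\<alpha> \<in> hom T T" and quad: "\<And>t. t \<in> carrier T \<Longrightarrow> \<mu> (\<alpha> t) = \<mu> t"
  shows "isometry \<alpha>"
proof -
  have closed: "\<alpha> t \<in> carrier T" if "t \<in> carrier T" for t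
    using hom that by (auto simp: hom_def)
  have bichar: "\<beta> (\<alpha> u) (\<alpha> v) = \<beta> u v" if "u \<in> carrier T" "v \<in> carrier T" for u v
    using that hom by (simp add: bichar_from_quad closed quad flip: hom_mult)
  have "inj_on \<alpha> (carrier T)"
  proof (rule inj_onI)
    fix u v assume "u \<in> carrier T" "v \<in> carrier T" "\<alpha> u = \<alpha> v"
    then show "u = v"
      by (intro bichar_unique) (simp_all flip: bichar)
  qed
  then have "bij_betw \<alpha> (carrier T) (carrier T)"
    using closed finite_carrier by (simp add: bij_betw_def endo_inj_surj image_subset_iff)
  then show ?thesis
    using assms by (simp add: isometry_def)
qed

text \<open>The reflection along \<open>u\<close>. When \<open>\<beta> t u = -1\<close>, multiplying
  by \<open>u\<close> changes \<open>\<mu> t\<close> by the factor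
  \<open>\<mu> u * \<beta> t u\<close>, and \<open>\<mu> u = -1\<close> makes this 1.\<close>

lemma transvection:
  assumes u: "u \<in> carrier T" "\<mu> u = -1"
  shows "isometry (\<lambda>t. if \<beta> t u = -1 then t \<otimes> u else t)"
proof (rule isometryI)
  show "(\<lambda>t. if \<beta> t u = -1 then t \<otimes> u else t) \<in> hom T T"
  proof (rule homI)
    fix x y assume "x \<in> carrier T" "y \<in> carrier T"
    then show "(if \<beta> (x \<otimes> y) u = -1 then x \<otimes> y \<otimes> u else x \<otimes> y) =
        (if \<beta> x u = -1 then x \<otimes> u else x) \<otimes> (if \<beta> y u = -1 then y \<otimes> u else y)"
      using u bichar_sign[of x u] bichar_sign[of y u]
      by (auto simp: bichar_mult_left m_ac square_one)
  qed (use u in auto)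
qed (use u in \<open>auto simp: quad_mult\<close>)

text \<open>Written additively, this is \<open>t \<mapsto> t + \<beta>(t,z) w + \<beta>(t,w) z + q(w) \<beta>(t,z) z\<close>, where \<open>q\<close> is
  the additive form of \<open>\<mu>\<close>. It is needed because the isometry group of the hyperbolic space of order
  16 is not generated by transvections.\<close>

lemma siegel_map:
  assumes z: "z \<in> carrier T" "\<mu> z = 1" and w: "w \<in> carrier T" and zw: "\<beta> z w = 1"
  shows "isometry (\<lambda>t. t \<otimes> (if \<beta> t z = -1 then w else \<one>) \<otimes>
    (if \<beta> t w * (if \<mu> w = -1 then \<beta> t z else 1) = -1 then z else \<one>))"
    (is "isometry ?E")
proof (rule isometryI)
  show "?E \<in> hom T T"
  proof (rule homI)
    fix x y assume "x \<in> carrier T" "y \<in> carrier T"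
    then show "?E (x \<otimes> y) = ?E x \<otimes> ?E y"
      using z w bichar_sign[of x z] bichar_sign[of y z] bichar_sign[of x w] bichar_sign[of y w]
      by (auto simp: bichar_mult_left m_ac square_one)
  qed (use z w in auto)
next
  \<comment> \<open>Additively, \<open>q(w) \<beta>(t,z)\<close> and
    \<open>\<beta>(t,z) \<beta>(t,w)\<close> both occur twice in the value at the image, while
    \<open>q(z)\<close> and \<open>\<beta>(z,w)\<close> vanish.\<close>
  fix t assume "t \<in> carrier T"
  then show "\<mu> (?E t) = \<mu> t"
    using z w zw bichar_sign[of t z] bichar_sign[of t w] quad_sign[of w]
    by (auto simp: quad_mult bichar_mult_left bichar_sym[of w z] bichar_one_left bichar_one_right quad_one)
qed

text \<open>The element \<open>c \<otimes> d\<close> has to be added to \<open>c\<close>. If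
  \<open>\<beta> c d = -1\<close>, its value under \<open>\<mu>\<close> is -1 and the transvection
  along it does so. Otherwise its value is 1 and the Siegel map along it is used:
  \<open>\<beta> c w = -1\<close> triggers the addition, and \<open>\<beta> d w = -1\<close> then
  makes \<open>w\<close> orthogonal to \<open>c \<otimes> d\<close>.\<close>

lemma isometry_transitive:
  assumes c: "c \<in> carrier T" "c \<noteq> \<one>" and d: "d \<in> carrier T" "d \<noteq> \<one>" and eq: "\<mu> c = \<mu> d"
  obtains \<alpha> where "isometry \<alpha>" "\<alpha> c = d"
proof (cases "\<beta> c d = -1")
  case True
  have "\<mu> (c \<otimes> d) = -1"
    using c d eq True by (simp add: quad_mult quad_square)
  moreover have "\<beta> c (c \<otimes> d) = -1"
    using c d True by (simp add: bichar_mult_right bichar_diag)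
  ultimately show ?thesis
    using that[OF transvection[of "c \<otimes> d"]] c d by simp
next
  case False
  then have cd: "\<beta> c d = 1"
    using bichar_sign[OF c(1) d(1)] by simp
  obtain w where w: "w \<in> carrier T" "\<beta> c w = -1" "\<beta> d w = -1"
    using exists_anticommuting2[OF c d] .
  have "\<mu> (c \<otimes> d) = 1" "\<beta> (c \<otimes> d) w = 1" "\<beta> c (c \<otimes> d) = 1"
    using c d eq cd w by (simp_all add: quad_mult quad_square bichar_mult_left bichar_mult_right bichar_diag)
  then show ?thesis
    using that[OF siegel_map[of "c \<otimes> d" w]] c d w by simp
qed

lemma alternating_bicharacter: "alternating_bicharacter T \<beta>"
  using bichar_sign
  by (auto simp: alternating_bicharacter_def bichar_mult_left bichar_mult_right bichar_diag)
    (metis insertE singletonD zero_neq_one zero_neq_neg_one)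

lemma type_I: "type_I T \<beta>"
  using nondegenerate by (auto simp: type_I_def bichar_one_right)

section \<open>Quadratic forms with polarization \<open>\<beta>\<close> as a torsor under
  \<open>T\<close>\<close>

abbreviation forms where "forms \<equiv> quadratic_forms_with_polarization T \<beta>"

text \<open>Signs are their own inverses, so the polarization condition turns into a product rule;
  being an alternating bicharacter is inherited from \<open>\<beta>\<close>.\<close>

lemma forms_iff:
  "\<eta> \<in> forms \<longleftrightarrow> \<eta> \<in> carrier T \<rightarrow>\<^sub>E {1, -1} \<and>
     (\<forall>u\<in>carrier T. \<forall>v\<in>carrier T. \<eta> (u \<otimes> v) = \<eta> u * \<eta> v * \<beta> u v)"
proof -
  have *: "polarization T \<eta> u v = \<beta> u v \<longleftrightarrow> \<eta> (u \<otimes> v) = \<eta> u * \<eta> v * \<beta> u v"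
    if sign: "\<eta> \<in> carrier T \<rightarrow>\<^sub>E {1, -1}" and uv: "u \<in> carrier T" "v \<in> carrier T" for u v
    using PiE_mem[OF sign uv(1)] PiE_mem[OF sign uv(2)] by (auto simp: polarization_def)
  have "alternating_bicharacter T (polarization T \<eta>)"
    if "\<And>u v. \<lbrakk>u \<in> carrier T; v \<in> carrier T\<rbrakk> \<Longrightarrow> polarization T \<eta> u v = \<beta> u v"
    using alternating_bicharacter that by (simp add: alternating_bicharacter_def)
  then show ?thesis
    using * unfolding quadratic_forms_with_polarization_def quadratic_form_def by blast
qed

definition twist :: "'g \<Rightarrow> 'g \<Rightarrow> real" where
  "twist c = (\<lambda>t\<in>carrier T. \<mu> t * \<beta> c t)"

lemma twist_form:
  assumes c: "c \<in> carrier T"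
  shows "twist c \<in> forms"
proof -
  have "\<mu> t * \<beta> c t \<in> {1, -1}" if "t \<in> carrier T" for t
    using quad_sign[OF that] bichar_sign[OF c that] by auto
  then show ?thesis
    using c unfolding forms_iff twist_def
    by (simp add: quad_mult bichar_mult_right mult_ac)
qed

lemma inj_twist: "inj_on twist (carrier T)"
proof (rule inj_onI)
  fix c d assume c: "c \<in> carrier T" and d: "d \<in> carrier T" and eq: "twist c = twist d"
  have "\<beta> c t = \<beta> d t" if t: "t \<in> carrier T" for t
    using fun_cong[OF eq, of t] t quad_sign[OF t] by (auto simp: twist_def)
  then show "c = d"
    by (rule bichar_unique[OF c d])
qed

text \<open>\<open>\<mu>\<close> and \<open>\<eta>\<close> deviate from multiplicativity by the same
  \<open>\<beta>\<close>, so their product is a character and hence some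
  \<open>\<beta> c\<close>.\<close>

lemma form_eq_twist:
  assumes "\<eta> \<in> forms"
  obtains c where "c \<in> carrier T" "\<eta> = twist c"
proof -
  have ext: "\<eta> \<in> carrier T \<rightarrow>\<^sub>E {1, -1}"
    and mult: "\<And>u v. \<lbrakk>u \<in> carrier T; v \<in> carrier T\<rbrakk> \<Longrightarrow> \<eta> (u \<otimes> v) = \<eta> u * \<eta> v * \<beta> u v"
    using assms by (simp_all add: forms_iff)
  have hom: "\<mu> (u \<otimes> v) * \<eta> (u \<otimes> v) = \<mu> u * \<eta> u * (\<mu> v * \<eta> v)"
    if uv: "u \<in> carrier T" "v \<in> carrier T" for u v
    using bichar_square[OF uv] by (simp add: quad_mult mult uv mult_ac)
  have sign: "\<mu> t * \<eta> t \<in> {1, -1}" if "t \<in> carrier T" for t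
    using quad_sign[OF that] PiE_mem[OF ext that] by auto
  obtain c where c: "c \<in> carrier T" "\<And>t. t \<in> carrier T \<Longrightarrow> \<mu> t * \<eta> t = \<beta> c t"
    using character_representable[of "\<lambda>t. \<mu> t * \<eta> t", OF hom sign] by blast
  have "\<eta> = twist c"
  proof
    fix t show "\<eta> t = twist c t"
    proof (cases "t \<in> carrier T")
      case True
      then show ?thesis
        using c(2)[OF True] quad_sign[OF True] by (auto simp: twist_def)
    next
      case False
      then show ?thesis
        using PiE_arb[OF ext False] by (simp add: twist_def)
    qed
  qed
  then show ?thesis
    using that c(1) by blast
qed

lemma card_forms: "card forms = card (carrier T)"
proof -
  have "forms = twist ` carrier T"
    using twist_form form_eq_twist by blast
  then show ?thesis
    by (simp add: card_image[OF inj_twist])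
qed

lemma form_sign: "\<lbrakk>\<eta> \<in> forms; t \<in> carrier T\<rbrakk> \<Longrightarrow> \<eta> t \<in> {1, -1}"
  by (auto simp: forms_iff dest: PiE_mem)

text \<open>\<open>pos\<close> says that \<open>\<mu>\<close> itself has Arf invariant +1; with a
  negative sum the two values would be exchanged.\<close>

lemma Arf_twist:
  assumes pos: "(\<Sum>t\<in>carrier T. \<mu> t) > 0" and c: "c \<in> carrier T"
  shows "Arf T (twist c) = (if \<mu> c = 1 then 1 else -1)"
proof -
  have "(\<Sum>t\<in>carrier T. twist c t) = \<mu> c * (\<Sum>t\<in>carrier T. \<mu> t)"
    using sum_quad_twist[OF c] by (simp add: twist_def)
  then show ?thesis
    using Arf_eq_sum[OF finite_carrier form_sign[OF twist_form[OF c]]] pos quad_sign[OF c]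
    by auto
qed

lemma twist_one:
  assumes "\<mu> \<in> forms"
  shows "twist \<one> = \<mu>"
  using assms by (auto simp: forms_iff twist_def bichar_one_left PiE_restrict cong: restrict_cong)

text \<open>The three sets are spelled out exactly as in the classification theorem, so that the
  definition can be folded there.\<close>

definition same_class :: "('g \<Rightarrow> real) \<Rightarrow> ('g \<Rightarrow> real) \<Rightarrow> bool" where
  "same_class \<eta> \<eta>' \<longleftrightarrow> (\<exists>S \<in> {{\<mu>}, {\<kappa> \<in> forms. Arf T \<kappa> = 1 \<and> \<kappa> \<noteq> \<mu>}, {\<kappa> \<in> forms. Arf T \<kappa> = -1}}.
     \<eta> \<in> S \<and> \<eta>' \<in> S)"

lemma same_class_twist_iff:
  assumes \<mu>: "\<mu> \<in> forms" and pos: "(\<Sum>t\<in>carrier T. \<mu> t) > 0" and c: "c \<in> carrier T" and d: "d \<in> carrier T"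
  shows "same_class (twist c) (twist d) \<longleftrightarrow> \<mu> c = \<mu> d \<and> (c = \<one> \<longleftrightarrow> d = \<one>)"
proof -
  have "twist e = \<mu> \<longleftrightarrow> e = \<one>" if "e \<in> carrier T" for e
    using twist_one[OF \<mu>] inj_onD[OF inj_twist _ that one_closed] by auto
  then show ?thesis
    using Arf_twist[OF pos c] Arf_twist[OF pos d] twist_form c d quad_sign[OF c] quad_sign[OF d] quad_one
    by (auto simp: same_class_def)
qed

text \<open>An isometry preserves \<open>\<beta>\<close> as well, so one that sends \<open>c\<close>
  to \<open>d\<close> sends the twist by \<open>c\<close> to the twist by \<open>d\<close>. For
  \<open>c = \<one>\<close> the identity serves.\<close>

lemma same_class_isometry:
  assumes \<mu>: "\<mu> \<in> forms" and pos: "(\<Sum>t\<in>carrier T. \<mu> t) > 0"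
    and \<eta>: "\<eta> \<in> forms" "\<eta>' \<in> forms" "same_class \<eta> \<eta>'"
  obtains \<alpha> where "isometry \<alpha>" "\<And>t. t \<in> carrier T \<Longrightarrow> \<eta>' (\<alpha> t) = \<eta> t"
proof -
  obtain c d where c: "c \<in> carrier T" "\<eta> = twist c" and d: "d \<in> carrier T" "\<eta>' = twist d"
    using form_eq_twist \<eta> by metis
  have cd: "\<mu> c = \<mu> d" "c = \<one> \<longleftrightarrow> d = \<one>"
    using same_class_twist_iff[OF \<mu> pos c(1) d(1)] \<eta>(3) c d by simp_all
  obtain \<alpha> where \<alpha>: "isometry \<alpha>" "\<alpha> c = d"
  proof (cases "c = \<one>")
    case True
    have "isometry (\<lambda>t. t)"
      by (rule isometryI) (auto simp: hom_def)
    then show ?thesis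
      using that True cd by blast
  next
    case False
    then show ?thesis
      using isometry_transitive[OF c(1) _ d(1)] cd that by blast
  qed
  have hom: "\<alpha> \<in> hom T T" and quad: "\<And>t. t \<in> carrier T \<Longrightarrow> \<mu> (\<alpha> t) = \<mu> t"
    using \<alpha> by (simp_all add: isometry_def)
  have closed: "\<alpha> t \<in> carrier T" if "t \<in> carrier T" for t
    using hom that by (rule hom_in_carrier)
  have "\<eta>' (\<alpha> t) = \<eta> t" if t: "t \<in> carrier T" for t
  proof -
    have "\<beta> (\<alpha> c) (\<alpha> t) = \<beta> c t"
      using c t by (simp add: bichar_from_quad closed quad flip: hom_mult[OF hom])
    then show ?thesis
      using c d t \<alpha>(2) by (simp add: twist_def closed quad)
  qed
  then show ?thesis
    using that \<alpha>(1) by blast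
qed

text \<open>Counting is enough: a bijection preserves the sum of the values, from which
  \<open>\<mu> c\<close> is read off, and it preserves agreement with \<open>\<mu>\<close>. The
  degree map of an equivalence can thus be fed in as a mere bijection.\<close>

lemma bijection_same_class:
  assumes \<mu>: "\<mu> \<in> forms" and pos: "(\<Sum>t\<in>carrier T. \<mu> t) > 0" and \<eta>: "\<eta> \<in> forms" "\<eta>' \<in> forms"
    and bij: "bij_betw \<alpha> (carrier T) (carrier T)"
    and quad: "\<And>t. t \<in> carrier T \<Longrightarrow> \<mu> (\<alpha> t) = \<mu> t"
    and eq: "\<And>t. t \<in> carrier T \<Longrightarrow> \<eta>' (\<alpha> t) = \<eta> t"
  shows "same_class \<eta> \<eta>'"
proof -
  obtain c d where c: "c \<in> carrier T" "\<eta> = twist c" and d: "d \<in> carrier T" "\<eta>' = twist d"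
    using form_eq_twist \<eta> by metis
  have "(\<Sum>t\<in>carrier T. \<eta>' t) = (\<Sum>t\<in>carrier T. \<eta>' (\<alpha> t))"
    by (rule sum.reindex_bij_betw[OF bij, symmetric])
  also have "\<dots> = (\<Sum>t\<in>carrier T. \<eta> t)"
    by (simp add: eq)
  finally have "\<mu> d * (\<Sum>t\<in>carrier T. \<mu> t) = \<mu> c * (\<Sum>t\<in>carrier T. \<mu> t)"
    using sum_quad_twist c d by (simp add: twist_def)
  then have "\<mu> c = \<mu> d"
    using pos by simp
  moreover have "\<eta> = \<mu> \<longleftrightarrow> \<eta>' = \<mu>"
  proof -
    have "\<kappa> = \<mu> \<longleftrightarrow> (\<forall>t\<in>carrier T. \<kappa> t = \<mu> t)" if "\<kappa> \<in> forms" for \<kappa>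
      using that \<mu> unfolding forms_iff by (metis PiE_ext)
    moreover have "(\<forall>t\<in>carrier T. \<eta>' t = \<mu> t) \<longleftrightarrow> (\<forall>t\<in>carrier T. \<eta>' (\<alpha> t) = \<mu> (\<alpha> t))"
      using bij_betw_imp_surj_on[OF bij] by (metis imageE imageI)
    ultimately show ?thesis
      using \<eta> by (simp add: quad eq)
  qed
  moreover have "twist e = \<mu> \<longleftrightarrow> e = \<one>" if "e \<in> carrier T" for e
    using twist_one[OF \<mu>] inj_onD[OF inj_twist _ that one_closed] by auto
  ultimately show ?thesis
    using same_class_twist_iff[OF \<mu> pos c(1) d(1)] c d by simp
qed

end

section \<open>The trace form on matrices\<close>

lemma central_matrix_scalar:
  fixes A :: "real^'n^'n"
  assumes "\<And>B. A ** B = B ** A"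
  obtains c where "A = c *\<^sub>R mat 1"
proof -
  have eq: "A $ a $ i = (if a = i then A $ j $ j else 0)" for a i j
  proof -
    \<comment> \<open>Comparing the \<open>(a, j)\<close> entries of both products with this matrix
      unit yields zero off the diagonal and equality of the diagonal entries at once.\<close>
    let ?E = "(\<chi> k l. if k = i \<and> l = j then 1 else 0) :: real^'n^'n"
    have "A $ a $ i = (\<Sum>k\<in>UNIV. if k = i then A $ a $ k else 0)"
      by simp
    also have "\<dots> = (A ** ?E) $ a $ j"
      unfolding matrix_matrix_mult_def vec_lambda_beta by (rule sum.cong) auto
    also have "\<dots> = (?E ** A) $ a $ j"
      by (rule arg_cong[OF assms, of "\<lambda>M. M $ a $ j"])
    also have "\<dots> = (\<Sum>k\<in>UNIV. if k = j then if a = i then A $ k $ j else 0 else 0)"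
      unfolding matrix_matrix_mult_def vec_lambda_beta by (rule sum.cong) auto
    finally show ?thesis
      by simp
  qed
  \<comment> \<open>\<open>undefined\<close> is just some index; index types are nonempty.\<close>
  have "A $ a $ i = ((A $ undefined $ undefined) *\<^sub>R mat 1) $ a $ i" for a i
    using eq[of a i undefined] by (simp add: mat_def)
  then have "A = (A $ undefined $ undefined) *\<^sub>R mat 1"
    unfolding vec_eq_iff by blast
  then show ?thesis
    using that by blast
qed

lemma trace_transpose_mult: "trace (x ** transpose x) = (\<Sum>i\<in>UNIV. \<Sum>j\<in>UNIV. (x $ i $ j)\<^sup>2)"
  for x :: "real^'n^'n"
  by (simp add: trace_def matrix_matrix_mult_def transpose_def power2_eq_square)

lemma trace_square_symmetric_nonneg:
  fixes x :: "real^'n^'n"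
  assumes "transpose x = x"
  shows "trace (x ** x) \<ge> 0"
  using trace_transpose_mult[of x] by (simp add: assms sum_nonneg)

lemma linear_transpose: "linear (transpose :: real^'n^'m \<Rightarrow> real^'m^'n)"
  by (rule linearI) (simp_all add: transpose_def vec_eq_iff)

lemma subspace_symmetric: "subspace {x :: real^'n^'n. transpose x = x}"
  by (auto simp: subspace_def linear_add[OF linear_transpose] linear_cmul[OF linear_transpose]
      linear_0[OF linear_transpose])

lemma subspace_skew: "subspace {x :: real^'n^'n. transpose x = - x}"
  by (auto simp: subspace_def linear_add[OF linear_transpose] linear_cmul[OF linear_transpose]
      linear_0[OF linear_transpose])

text \<open>No basis is counted. Flipping the sign of all entries on one side of the diagonal sends
  skew matrices injectively to symmetric ones with zero diagonal, and the identity matrix is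
  missed.\<close>

lemma dim_skew_less_dim_symmetric:
  "dim {x :: real^'n^'n. transpose x = - x} < dim {x :: real^'n^'n. transpose x = x}"
    (is "dim ?A < dim ?S")
proof -
  \<comment> \<open>The index type carries no order; \<open>r\<close> borrows one, so that the two
    sides of the diagonal make sense.\<close>
  obtain r :: "'n \<Rightarrow> nat" where r: "inj r"
    using finite_imp_inj_to_nat_seg[of "UNIV :: 'n set"] by auto
  define s where "s i j = (if r i < r j then 1 else if r j < r i then -1 else 0 :: real)" for i j
  define L where "L x = (\<chi> i j. x $ i $ j * s i j)" for x :: "real^'n^'n"
  have s: "s j i = - s i j" for i j
    by (simp add: s_def)
  have skew: "x $ j $ i = - (x $ i $ j)" if "x \<in> ?A" for x i j
  proof -
    have "transpose x $ i $ j = (- x) $ i $ j"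
      using that by simp
    then show ?thesis
      by (simp add: transpose_def)
  qed
  have lin: "linear L"
    by (rule linearI) (simp_all add: L_def vec_eq_iff algebra_simps)
  have inj: "inj_on L ?A"
  proof (rule inj_onI)
    fix x y assume x: "x \<in> ?A" and y: "y \<in> ?A" and eq: "L x = L y"
    have "x $ i $ j = y $ i $ j" for i j
    proof (cases "i = j")
      case True
      have "x $ i $ i = 0" "y $ i $ i = 0"
        using skew[OF x, of i i] skew[OF y, of i i] by linarith+
      then show ?thesis
        using True by simp
    next
      case False
      then have "r i \<noteq> r j"
        using r by (simp add: inj_eq)
      then have "s i j \<noteq> 0"
        by (simp add: s_def)
      moreover have "x $ i $ j * s i j = y $ i $ j * s i j"
        using eq by (simp add: L_def vec_eq_iff)
      ultimately show ?thesis
        by simp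
    qed
    then show "x = y"
      by (simp add: vec_eq_iff)
  qed
  have span: "span ?A = ?A"
    by (simp add: span_eq_iff subspace_skew)
  have "dim ?A = dim (L ` ?A)"
    using dim_image_eq[OF lin, of ?A] inj by (simp add: span)
  also have "\<dots> < dim ?S"
  proof (rule dim_psubset)
    have "L ` ?A \<subseteq> ?S"
    proof (rule image_subsetI)
      fix x assume x: "x \<in> ?A"
      have "transpose (L x) $ i $ j = L x $ i $ j" for i j
        using skew[OF x, of i j] s[of i j] by (simp add: L_def transpose_def)
      then show "L x \<in> ?S"
        by (simp add: vec_eq_iff)
    qed
    moreover have "mat 1 \<in> ?S"
      by simp
    moreover have "mat 1 \<notin> L ` ?A"
    proof
      assume "mat 1 \<in> L ` ?A"
      then obtain x where "mat 1 = L x"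
        by blast
      then have "(mat 1 :: real^'n^'n) $ undefined $ undefined = L x $ undefined $ undefined"
        by simp
      then show False
        by (simp add: mat_def L_def s_def)
    qed
    ultimately have "L ` ?A \<subset> ?S"
      by blast
    then show "span (L ` ?A) \<subset> span ?S"
      by (simp add: linear_span_image[OF lin] span span_eq_iff[THEN iffD2, OF subspace_symmetric])
  qed
  finally show ?thesis .
qed

text \<open>Trivial intersection with the symmetric matrices bounds \<open>dim W\<close> by the
  dimension of the skew ones, which is less than half of the total.\<close>

lemma dim_negative_trace_subspace:
  fixes W :: "(real^'n^'n) set"
  assumes W: "subspace W" and neg: "\<And>x. \<lbrakk>x \<in> W; x \<noteq> 0\<rbrakk> \<Longrightarrow> trace (x ** x) < 0"
  shows "2 * dim W < CARD('n) * CARD('n)"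
proof -
  let ?A = "{x :: real^'n^'n. transpose x = - x}" and ?S = "{x :: real^'n^'n. transpose x = x}"
  have dimU: "dim (UNIV :: (real^'n^'n) set) = CARD('n) * CARD('n)"
    by simp
  have "W \<inter> ?S = {0}"
    using trace_square_symmetric_nonneg[where 'n='n] neg subspace_0[OF W]
      subspace_0[OF subspace_symmetric[where 'n='n]]
    by (auto simp: not_less[symmetric])
  then have "dim W + dim ?S = dim {x + y |x y. x \<in> W \<and> y \<in> ?S}"
    using dim_sums_Int[OF W subspace_symmetric] by simp
  also have "\<dots> \<le> CARD('n) * CARD('n)"
    using dim_subset_UNIV[of "{x + y |x y. x \<in> W \<and> y \<in> ?S}"] by simp
  finally have 1: "dim W + dim ?S \<le> CARD('n) * CARD('n)" .
  have "{x + y |x y. x \<in> ?S \<and> y \<in> ?A} = UNIV"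
  proof (intro equalityI subsetI UNIV_I)
    fix x :: "real^'n^'n"
    have "x = (1/2) *\<^sub>R (x + transpose x) + (1/2) *\<^sub>R (x - transpose x)"
      by (simp add: vec_eq_iff field_simps)
    moreover have "(1/2) *\<^sub>R (x + transpose x) \<in> ?S" "(1/2) *\<^sub>R (x - transpose x) \<in> ?A"
      by (simp_all add: transpose_def vec_eq_iff field_simps)
    ultimately show "x \<in> {x + y |x y. x \<in> ?S \<and> y \<in> ?A}"
      by blast
  qed
  moreover have "?S \<inter> ?A = {0}"
    by (auto simp: eq_neg_iff_add_eq_0 linear_0[OF linear_transpose] simp flip: scaleR_2)
  ultimately have "dim ?S + dim ?A = CARD('n) * CARD('n)"
    using dim_sums_Int[OF subspace_symmetric[where 'n='n] subspace_skew[where 'n='n]] by simp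
  then show ?thesis
    using 1 dim_skew_less_dim_symmetric[where 'n='n] by linarith
qed

lemma linear_trace: "linear (trace :: real^'n^'n \<Rightarrow> real)"
  by (rule linearI) (simp_all add: trace_def sum.distrib sum_distrib_left)

section \<open>Division gradings on matrix algebras\<close>

text \<open>The algebra stays abstract; matrices enter through \<open>f\<close> for three purposes:
  dimension, center and trace.\<close>

locale matrix_division_grading =
  comm_group G for G :: "('g, 'c) monoid_scheme" (structure) +
  fixes D :: "'g \<Rightarrow> 'a::real_algebra_1 set" and f :: "'a \<Rightarrow> real^'n^'n"
  assumes matrix_iso: "matrix_algebra_iso f" and one_dim: "one_dim_division_grading G D"
begin

abbreviation T where "T \<equiv> support G D"

section \<open>Homogeneous components, units and the support\<close>

lemma grading: "grading G D"
  using one_dim by (simp add: one_dim_division_grading_def division_grading_def)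

lemma component_subspace: "g \<in> carrier G \<Longrightarrow> subspace (D g)"
  using grading by (simp add: grading_def)

lemma component_mult:
  "\<lbrakk>g \<in> carrier G; h \<in> carrier G; x \<in> D g; y \<in> D h\<rbrakk> \<Longrightarrow> x * y \<in> D (g \<otimes> h)"
  using grading by (simp add: grading_def)

text \<open>A prescribed degree \<open>k\<close> may be forced into the index set, so that its
  component can be named even where it vanishes.\<close>

lemma decompose:
  obtains S c where "finite S" "S \<subseteq> carrier G" "k \<in> carrier G \<Longrightarrow> k \<in> S"
    "\<And>g. g \<in> S \<Longrightarrow> c g \<in> D g" "x = (\<Sum>g\<in>S. c g)"
proof -
  from grading have "\<exists>c. (\<forall>g\<in>carrier G. c g \<in> D g) \<and> (\<forall>g. g \<notin> carrier G \<longrightarrow> c g = 0) \<and>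
      finite {g. c g \<noteq> 0} \<and> x = (\<Sum>g\<in>{g. c g \<noteq> 0}. c g)"
    unfolding grading_def by (blast dest: ex1_implies_ex)
  then obtain c where c: "\<forall>g\<in>carrier G. c g \<in> D g" "\<forall>g. g \<notin> carrier G \<longrightarrow> c g = 0"
    "finite {g. c g \<noteq> 0}" "x = (\<Sum>g\<in>{g. c g \<noteq> 0}. c g)"
    by blast
  let ?S = "{g. c g \<noteq> 0} \<union> ({k} \<inter> carrier G)"
  have "x = (\<Sum>g\<in>?S. c g)"
    unfolding c(4) using c(3) by (intro sum.mono_neutral_left) auto
  then show ?thesis
    using that[of ?S c] c by auto
qed

text \<open>The expansion is indexed through a degree map \<open>p\<close> because later uses index
  it by translated degrees (\<open>product_components\<close>) and by basis vectors
  (\<open>homogeneous_basis_independent\<close>).\<close>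

lemma components_unique:
  assumes S: "finite S" "inj_on p S" "p ` S \<subseteq> carrier G"
    and ab: "\<And>i. i \<in> S \<Longrightarrow> a i \<in> D (p i)" "\<And>i. i \<in> S \<Longrightarrow> b i \<in> D (p i)"
    and eq: "sum a S = sum b S" and i: "i \<in> S"
  shows "a i = b i"
proof -
  \<comment> \<open>Extension by zero to all degrees, as the uniqueness clause of
    \<open>grading\<close> demands.\<close>
  define e where "e a g = (if g \<in> p ` S then a (the_inv_into S p g) else 0 :: 'a)" for a g
  define P where "P c \<longleftrightarrow> (\<forall>g\<in>carrier G. c g \<in> D g) \<and> (\<forall>g. g \<notin> carrier G \<longrightarrow> c g = 0) \<and>
      finite {g. c g \<noteq> 0} \<and> sum a S = (\<Sum>g\<in>{g. c g \<noteq> 0}. c g)" for c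
  have e_at: "e c (p j) = c j" if "j \<in> S" for c j
    using that S by (simp add: e_def the_inv_into_f_f)
  have P: "P (e c)" if c: "\<And>j. j \<in> S \<Longrightarrow> c j \<in> D (p j)" "sum c S = sum a S" for c
  proof -
    have sub: "{g. e c g \<noteq> 0} \<subseteq> p ` S"
      by (auto simp: e_def)
    have "sum c S = (\<Sum>j\<in>S. e c (p j))"
      by (simp add: e_at)
    also have "\<dots> = sum (e c) (p ` S)"
      using sum.reindex[OF S(2), of "e c"] by simp
    also have "\<dots> = (\<Sum>g\<in>{g. e c g \<noteq> 0}. e c g)"
      using S(1) sub by (intro sum.mono_neutral_right) auto
    finally have sum: "sum a S = (\<Sum>g\<in>{g. e c g \<noteq> 0}. e c g)"
      using c(2) by simp
    have "e c g \<in> D g" if "g \<in> carrier G" for g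
    proof (cases "g \<in> p ` S")
      case True
      then show ?thesis
        using c(1) e_at by auto
    next
      case False
      then show ?thesis
        using component_subspace[OF that] by (simp add: e_def subspace_0)
    qed
    moreover have "finite {g. e c g \<noteq> 0}"
      using finite_subset[OF sub] S(1) by simp
    ultimately show ?thesis
      using sum sub S(3) unfolding P_def by (auto simp: e_def)
  qed
  have "\<exists>!c. P c"
    using grading unfolding grading_def P_def by blast
  then have "e a = e b"
    using P[of a] P[of b] ab eq by auto
  then show ?thesis
    using e_at[OF i, of a] e_at[OF i, of b] by simp
qed

text \<open>Left multiplication by \<open>x\<close> shifts all degrees injectively, so a homogeneous
  product reveals the components of its second factor. This locates the degrees of 1 and of
  inverses.\<close>

lemma product_components:
  assumes h: "h \<in> carrier G" and x: "x \<in> D h" and S: "finite S" "S \<subseteq> carrier G"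
    and c: "\<And>g. g \<in> S \<Longrightarrow> c g \<in> D g" and k: "k \<in> S" and z: "z \<in> D (h \<otimes> k)"
    and eq: "x * (\<Sum>g\<in>S. c g) = z" and g: "g \<in> S"
  shows "x * c g = (if g = k then z else 0)"
proof (rule components_unique[of S "\<lambda>g. h \<otimes> g" "\<lambda>g. x * c g" "\<lambda>g. if g = k then z else 0"])
  show "inj_on (\<lambda>g. h \<otimes> g) S"
    using inj_on_cmult[OF h] S(2) by (rule inj_on_subset)
  show "(\<Sum>g\<in>S. x * c g) = (\<Sum>g\<in>S. if g = k then z else 0)"
    using eq S k by (simp add: sum_distrib_left)
  show "x * c i \<in> D (h \<otimes> i)" if "i \<in> S" for i
    using component_mult h x c S that by blast
  show "(if i = k then z else 0) \<in> D (h \<otimes> i)" if "i \<in> S" for i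
    using z that h S component_subspace[of "h \<otimes> i"] by (auto intro: subspace_0)
qed (use S h g in auto)

text \<open>The component of 1 in degree \<open>\<one>\<close> is a right identity for every
  homogeneous element, hence for 1, and so equals 1.\<close>

lemma one_component: "1 \<in> D \<one>"
proof -
  obtain S c where S: "finite S" "S \<subseteq> carrier G" "\<one> \<in> S"
    and c: "\<And>g. g \<in> S \<Longrightarrow> c g \<in> D g" and sum: "1 = (\<Sum>g\<in>S. c g)"
    using decompose[of "\<one>" 1] by (metis one_closed)
  have "x * c \<one> = x" if "h \<in> carrier G" "x \<in> D h" for h x
    using product_components[OF that S(1,2) c S(3), where z = x and g = \<one>] that S(3) sum[symmetric] by simp
  then have "(\<Sum>g\<in>S. c g) * c \<one> = (\<Sum>g\<in>S. c g)"
    unfolding sum_distrib_right using S c by (intro sum.cong) auto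
  then have "c \<one> = 1"
    by (simp flip: sum)
  then show ?thesis
    using c S(3) by metis
qed

text \<open>The component of the inverse in degree \<open>inv h\<close> is a right inverse already;
  uniqueness of inverses identifies the two.\<close>

lemma homogeneous_inverse:
  assumes h: "h \<in> carrier G" and x: "x \<in> D h" "x \<noteq> 0"
  obtains y where "y \<in> D (inv h)" "x * y = 1" "y * x = 1"
proof -
  obtain y where y: "x * y = 1" "y * x = 1"
    using one_dim h x unfolding one_dim_division_grading_def division_grading_def by blast
  obtain S c where S: "finite S" "S \<subseteq> carrier G" "inv h \<in> S"
    and c: "\<And>g. g \<in> S \<Longrightarrow> c g \<in> D g" and sum: "y = (\<Sum>g\<in>S. c g)"
    using decompose[of "inv h" y] h by (metis inv_closed)
  have "x * c (inv h) = 1"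
    using product_components[OF h x(1) S(1,2) c S(3), where z = 1 and g = "inv h"] h S(3) y(1)
      one_component by (simp flip: sum)
  then have "c (inv h) = y"
    using y by (metis mult.assoc mult_1 mult_1_right)
  then show ?thesis
    using that c[OF S(3)] y by simp
qed

lemma homogeneous_mult_nonzero:
  assumes "h \<in> carrier G" "x \<in> D h" "x \<noteq> 0" "y \<noteq> 0"
  shows "x * y \<noteq> 0"
proof
  assume "x * y = 0"
  moreover obtain z where "z * x = 1"
    using homogeneous_inverse assms by blast
  ultimately show False
    using assms(4) by (metis mult.assoc mult_1 mult_zero_right)
qed

lemma support_iff: "t \<in> T \<longleftrightarrow> t \<in> carrier G \<and> (\<exists>x\<in>D t. x \<noteq> 0)"
  using component_subspace[of t] subspace_0[of "D t"] by (auto simp: support_def)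

lemma support_carrier: "t \<in> T \<Longrightarrow> t \<in> carrier G"
  by (simp add: support_iff)

lemma subgroup_support: "subgroup T G"
proof
  show "T \<subseteq> carrier G"
    using support_carrier by auto
  show "u \<otimes> v \<in> T" if "u \<in> T" "v \<in> T" for u v
    using that component_mult homogeneous_mult_nonzero unfolding support_iff by (metis m_closed)
  show "\<one> \<in> T"
    using one_component by (auto simp: support_iff intro!: bexI[of _ 1])
  show "inv u \<in> T" if u: "u \<in> T" for u
  proof -
    obtain x where x: "x \<in> D u" "x \<noteq> 0"
      using u by (auto simp: support_iff)
    then obtain y where "y \<in> D (inv u)" "x * y = 1"
      using homogeneous_inverse support_carrier[OF u] by metis
    then show ?thesis
      using u by (auto simp: support_iff intro!: bexI[of _ y])
  qed
qed

lemma comm_group_support: "comm_group (support_group G D)"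
proof -
  interpret S: group "support_group G D"
    by (rule subgroup.subgroup_is_group[OF subgroup_support is_group])
  show ?thesis
    by (rule S.group_comm_groupI) (simp add: m_comm support_carrier)
qed

definition X :: "'g \<Rightarrow> 'a" where
  "X t = (SOME x. x \<in> D t \<and> x \<noteq> 0)"

lemma X: "t \<in> T \<Longrightarrow> X t \<in> D t \<and> X t \<noteq> 0"
  unfolding X_def support_iff by (rule someI_ex) auto

lemma component_multiple:
  assumes t: "t \<in> T" and x: "x \<in> D t" "x \<noteq> 0" and y: "y \<in> D t"
  obtains r where "y = r *\<^sub>R x"
proof -
  have "dim (D t) = 1"
    using one_dim t by (simp add: one_dim_division_grading_def)
  then obtain B where B: "B \<subseteq> D t" "independent B" "D t \<subseteq> span B" "card B = 1"
    using real_vector.basis_exists[of "D t"] by metis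
  then obtain b where b: "B = {b}"
    using card_1_singletonE by metis
  obtain r s where "x = r *\<^sub>R b" "y = s *\<^sub>R b"
    using B(3) x(1) y unfolding b span_singleton by blast
  moreover from this have "r \<noteq> 0"
    using x by auto
  ultimately show ?thesis
    using that[of "s / r"] by simp
qed

lemma component_eq:
  assumes t: "t \<in> T" and x: "x \<in> D t" "x \<noteq> 0"
  shows "D t = range (\<lambda>r. r *\<^sub>R x)"
proof
  show "D t \<subseteq> range (\<lambda>r. r *\<^sub>R x)"
    using component_multiple[OF t x] by blast
  show "range (\<lambda>r. r *\<^sub>R x) \<subseteq> D t"
    using x(1) subspace_scale[OF component_subspace[OF support_carrier[OF t]]] by blast
qed

lemma component_eq_X: "t \<in> T \<Longrightarrow> D t = range (\<lambda>r. r *\<^sub>R X t)"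
  by (rule component_eq) (simp_all add: X)

lemma component_outside: "\<lbrakk>g \<in> carrier G; g \<notin> T\<rbrakk> \<Longrightarrow> D g = {0}"
  by (simp add: support_def)

lemma components_disjoint:
  assumes "u \<in> carrier G" "v \<in> carrier G" "x \<in> D u" "x \<in> D v" "u \<noteq> v"
  shows "x = 0"
proof -
  have "0 \<in> D u" "0 \<in> D v"
    using assms component_subspace subspace_0 by blast+
  then have "(if u = u then x else 0) = (if u = v then x else 0)"
    using assms by (intro components_unique[of "{u, v}" id "\<lambda>i. if i = u then x else 0"
          "\<lambda>i. if i = v then x else 0"]) auto
  then show ?thesis
    using assms(5) by simp
qed

text \<open>A predicate, because beside the arbitrary choice \<open>X\<close> there will be bases
  with matched structure constants.\<close>

definition homogeneous_basis :: "('g \<Rightarrow> 'a) \<Rightarrow> bool" where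
  "homogeneous_basis Y \<longleftrightarrow> (\<forall>t\<in>T. Y t \<in> D t \<and> Y t \<noteq> 0)"

lemma homogeneous_basisD: "\<lbrakk>homogeneous_basis Y; t \<in> T\<rbrakk> \<Longrightarrow> Y t \<in> D t \<and> Y t \<noteq> 0"
  by (simp add: homogeneous_basis_def)

lemma homogeneous_basis_X: "homogeneous_basis X"
  by (simp add: homogeneous_basis_def X)

lemma homogeneous_basis_inj:
  assumes Y: "homogeneous_basis Y"
  shows "inj_on Y T"
proof (rule inj_onI)
  fix u v assume "u \<in> T" "v \<in> T" "Y u = Y v"
  then show "u = v"
    using components_disjoint[of u v "Y u"] homogeneous_basisD[OF Y, of u]
      homogeneous_basisD[OF Y, of v] support_carrier by auto
qed

section \<open>The commutation factor and homogeneous bases\<close>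

abbreviation \<beta> where "\<beta> \<equiv> grading_bichar D"

abbreviation \<mu> where "\<mu> \<equiv> grading_quad G D"

text \<open>Both orders of a product lie in the same line because \<open>G\<close> is abelian, and
  scaling does not change their ratio. So the description in \<open>grading_bichar\<close> is
  satisfied by a unique number.\<close>

lemma bichar:
  assumes u: "u \<in> T" and v: "v \<in> T" and x: "x \<in> D u" and y: "y \<in> D v"
  shows "x * y = \<beta> u v *\<^sub>R (y * x)"
proof -
  note X' = X[OF u] X[OF v] and c = support_carrier[OF u] support_carrier[OF v]
  have nz: "X v * X u \<noteq> 0"
    using homogeneous_mult_nonzero X' c by blast
  have vu: "v \<otimes> u \<in> T"
    using subgroup.m_closed[OF subgroup_support] u v by simp
  have "X v * X u \<in> D (v \<otimes> u)" "X u * X v \<in> D (v \<otimes> u)"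
    using component_mult[OF c(2,1)] component_mult[OF c] X' c by (simp_all add: m_comm)
  then obtain r where r: "X u * X v = r *\<^sub>R (X v * X u)"
    using component_multiple[OF vu] nz by metis
  have all: "x * y = r *\<^sub>R (y * x)" if "x \<in> D u" "y \<in> D v" for x y
    using that r unfolding component_eq_X[OF u] component_eq_X[OF v] by auto
  have "\<beta> u v = r"
    unfolding grading_bichar_def
  proof (rule the_equality)
    fix b assume "\<forall>x\<in>D u - {0}. \<forall>y\<in>D v - {0}. x * y = b *\<^sub>R (y * x)"
    then have "b *\<^sub>R (X v * X u) = r *\<^sub>R (X v * X u)"
      using X' r by (metis DiffI singletonD)
    then show "b = r"
      using nz by simp
  qed (use all in auto)
  then show ?thesis
    using all x y by simp
qed

lemma bichar_eqI:
  assumes u: "u \<in> T" and v: "v \<in> T" and x: "x \<in> D u" "x \<noteq> 0" and y: "y \<in> D v" "y \<noteq> 0"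
    and eq: "x * y = r *\<^sub>R (y * x)"
  shows "\<beta> u v = r"
proof -
  have "y * x \<noteq> 0"
    using homogeneous_mult_nonzero support_carrier v x y by blast
  moreover have "\<beta> u v *\<^sub>R (y * x) = r *\<^sub>R (y * x)"
    using bichar[OF u v x(1) y(1)] eq by metis
  ultimately show ?thesis
    by simp
qed

lemma support_mult: "\<lbrakk>u \<in> T; v \<in> T\<rbrakk> \<Longrightarrow> u \<otimes> v \<in> T"
  by (rule subgroup.m_closed[OF subgroup_support])

lemma support_one: "\<one> \<in> T"
  by (rule subgroup.one_closed[OF subgroup_support])

lemma X_mult: "\<lbrakk>u \<in> T; v \<in> T\<rbrakk> \<Longrightarrow> X u * X v \<in> D (u \<otimes> v) \<and> X u * X v \<noteq> 0"
  using component_mult homogeneous_mult_nonzero X support_carrier by metis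

lemma bichar_mult_left:
  assumes "u \<in> T" "v \<in> T" "w \<in> T"
  shows "\<beta> (u \<otimes> v) w = \<beta> u w * \<beta> v w"
proof (rule bichar_eqI)
  have "X u * X v * X w = X u * (\<beta> v w *\<^sub>R (X w * X v))"
    using bichar[of v w] X assms by (simp add: mult.assoc)
  also have "\<dots> = \<beta> v w *\<^sub>R ((X u * X w) * X v)"
    by (simp add: mult.assoc)
  also have "\<dots> = (\<beta> u w * \<beta> v w) *\<^sub>R (X w * (X u * X v))"
    using bichar[of u w "X u" "X w"] X assms by (simp add: mult.assoc mult.commute)
  finally show "X u * X v * X w = (\<beta> u w * \<beta> v w) *\<^sub>R (X w * (X u * X v))" .
qed (use assms X X_mult support_mult in auto)

lemma bichar_swap:
  assumes "u \<in> T" "v \<in> T"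
  shows "\<beta> u v * \<beta> v u = 1"
proof -
  have "X u * X v = (\<beta> u v * \<beta> v u) *\<^sub>R (X u * X v)"
    using bichar[of u v "X u" "X v"] bichar[of v u "X v" "X u"] X assms by simp
  then have "(\<beta> u v * \<beta> v u - 1) *\<^sub>R (X u * X v) = 0"
    by (simp add: scaleR_diff_left)
  then show ?thesis
    using X_mult[OF assms] by simp
qed

lemma bichar_diag: "u \<in> T \<Longrightarrow> \<beta> u u = 1"
  by (rule bichar_eqI[of u u "X u" "X u"]) (simp_all add: X)

lemma homogeneous_basis_span:
  assumes Y: "homogeneous_basis Y"
  shows "span (Y ` T) = UNIV"
proof (intro equalityI subset_UNIV subsetI)
  fix x
  obtain S c where S: "finite S" "S \<subseteq> carrier G" "\<And>g. g \<in> S \<Longrightarrow> c g \<in> D g" "x = (\<Sum>g\<in>S. c g)"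
    using decompose[of \<one> x] by metis
  have "c g \<in> span (Y ` T)" if g: "g \<in> S" for g
  proof (cases "g \<in> T")
    case True
    then obtain r where "c g = r *\<^sub>R Y g"
      using S(3)[OF g] component_eq[OF True] homogeneous_basisD[OF Y True] by blast
    then show ?thesis
      using True by (simp add: span_base span_scale)
  next
    case False
    then have "c g = 0"
      using S(2,3) g component_outside[of g] by auto
    then show ?thesis
      by (simp add: span_zero)
  qed
  then show "x \<in> span (Y ` T)"
    unfolding S(4) by (rule span_sum)
qed

lemma homogeneous_basis_independent:
  assumes Y: "homogeneous_basis Y"
  shows "independent (Y ` T)"
  unfolding real_vector.independent_explicit_finite_subsets
proof (intro allI impI ballI)
  fix A r x assume A: "A \<subseteq> Y ` T" "finite A" "(\<Sum>v\<in>A. r v *\<^sub>R v) = 0" and x: "x \<in> A"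
  let ?p = "the_inv_into T Y"
  have Y_inv: "?p a \<in> T" "Y (?p a) = a" if "a \<in> A" for a
    using that A(1) f_the_inv_into_f[OF homogeneous_basis_inj[OF Y], of a]
      the_inv_into_into[OF homogeneous_basis_inj[OF Y], of a T] by auto
  have in_D: "a \<in> D (?p a)" "a \<noteq> 0" if "a \<in> A" for a
    using homogeneous_basisD[OF Y Y_inv(1)[OF that]] Y_inv(2)[OF that] by simp_all
  have sub: "subspace (D (?p a))" if "a \<in> A" for a
    by (rule component_subspace[OF support_carrier[OF Y_inv(1)[OF that]]])
  have "r x *\<^sub>R x = 0"
  proof (rule components_unique[of A ?p "\<lambda>v. r v *\<^sub>R v" "\<lambda>v. 0"])
    show "inj_on ?p A"
      using Y_inv(2) by (rule inj_on_inverseI)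
    show "?p ` A \<subseteq> carrier G"
      using Y_inv(1) support_carrier by (intro image_subsetI) simp
    show "r i *\<^sub>R i \<in> D (?p i)" if i: "i \<in> A" for i
      by (rule subspace_scale[OF sub[OF i] in_D(1)[OF i]])
    show "0 \<in> D (?p i)" if i: "i \<in> A" for i
      by (rule subspace_0[OF sub[OF i]])
  qed (use A x in simp_all)
  moreover have "x \<noteq> 0"
    by (rule in_D(2)[OF x])
  ultimately show "r x = 0"
    by simp
qed

lemma span_X: "span (X ` T) = UNIV"
  by (rule homogeneous_basis_span[OF homogeneous_basis_X])

section \<open>What the matrix model forces on \<open>T\<close> and \<open>\<beta>\<close>\<close>

lemma f_linear: "linear f" and f_bij: "bij f" and f_mult: "f (x * y) = f x ** f y"
  and f_one: "f 1 = mat 1"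
  using matrix_iso by (simp_all add: matrix_algebra_iso_def)

lemma f_inj: "inj f"
  using f_bij by (rule bij_is_inj)

lemma independent_fX: "independent (f ` X ` T)"
  by (rule linear_independent_injective_image[OF f_linear homogeneous_basis_independent[OF homogeneous_basis_X]])
    (rule inj_on_subset[OF f_inj subset_UNIV])

lemma inj_fX: "inj_on (\<lambda>t. f (X t)) T"
  using comp_inj_on[OF homogeneous_basis_inj[OF homogeneous_basis_X] inj_on_subset[OF f_inj subset_UNIV]] by (simp add: comp_def)

lemma finite_support: "finite T"
proof -
  have "finite ((\<lambda>t. f (X t)) ` T)"
    using independent_imp_finite[OF independent_fX] by (simp add: image_image)
  then show ?thesis
    using finite_imageD inj_fX by blast
qed

lemma card_support: "card T = CARD('n) * CARD('n)"
proof -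
  have "card T = card ((\<lambda>t. f (X t)) ` T)"
    using card_image[OF inj_fX] by simp
  also have "\<dots> = dim (span (f ` X ` T))"
    using dim_eq_card_independent[OF independent_fX] by (simp add: image_image dim_span)
  also have "span (f ` X ` T) = UNIV"
    using linear_span_image[OF f_linear] span_X bij_is_surj[OF f_bij] by simp
  finally show ?thesis
    by simp
qed


lemma bichar_one_left:
  assumes v: "v \<in> T"
  shows "\<beta> \<one> v = 1"
proof -
  have "\<beta> \<one> v * \<beta> \<one> v = \<beta> (\<one> \<otimes> \<one>) v"
    by (rule bichar_mult_left[OF support_one support_one v, symmetric])
  also have "\<dots> = \<beta> \<one> v"
    by simp
  finally show ?thesis
    using bichar_swap[OF support_one v] by auto
qed

text \<open>The exponent of \<open>T\<close> is still unknown here. Translating the product of all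
  \<open>\<beta> t v\<close> by \<open>u\<close> shows that \<open>\<beta> u v\<close> has finite
  order, and the real roots of unity are signs.\<close>

lemma bichar_sign:
  assumes u: "u \<in> T" and v: "v \<in> T"
  shows "\<beta> u v \<in> {1, -1}"
proof -
  have inj: "inj_on (\<lambda>t. u \<otimes> t) T"
    using inj_on_cmult[OF support_carrier[OF u]] support_carrier by (meson inj_on_subset subsetI)
  moreover have "(\<lambda>t. u \<otimes> t) ` T \<subseteq> T"
    using support_mult[OF u] by blast
  ultimately have "bij_betw (\<lambda>t. u \<otimes> t) T T"
    unfolding bij_betw_def using endo_inj_surj[OF finite_support] by blast
  then have "(\<Prod>t\<in>T. \<beta> t v) = (\<Prod>t\<in>T. \<beta> (u \<otimes> t) v)"
    by (rule prod.reindex_bij_betw[symmetric])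
  also have "\<dots> = (\<Prod>t\<in>T. \<beta> u v * \<beta> t v)"
    using u v by (intro prod.cong refl bichar_mult_left)
  also have "\<dots> = \<beta> u v ^ card T * (\<Prod>t\<in>T. \<beta> t v)"
    by (simp add: prod.distrib)
  finally have "(\<Prod>t\<in>T. \<beta> t v) = \<beta> u v ^ card T * (\<Prod>t\<in>T. \<beta> t v)" .
  moreover have "(\<Prod>t\<in>T. \<beta> t v) \<noteq> 0"
    using bichar_swap[OF _ v] finite_support by fastforce
  ultimately have "\<beta> u v ^ card T = 1"
    by simp
  then have "\<bar>\<beta> u v\<bar> ^ card T = 1 ^ card T"
    using power_abs[of "\<beta> u v" "card T"] by simp
  then have "\<bar>\<beta> u v\<bar> = 1"
    by (rule power_eq_imp_eq_base) (simp_all add: card_support)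
  then show ?thesis
    by auto
qed

lemma bichar_sym: "\<lbrakk>u \<in> T; v \<in> T\<rbrakk> \<Longrightarrow> \<beta> u v = \<beta> v u"
  using bichar_swap[of u v] bichar_sign[of u v] by auto

lemma scalar_multiple_one: "x \<in> D \<one> \<Longrightarrow> \<exists>r. x = r *\<^sub>R 1"
  using component_multiple[OF support_one one_component] by (metis zero_neq_one)

text \<open>If \<open>\<beta>\<close> is trivial against \<open>t\<close>, then \<open>X t\<close>
  is central, hence a scalar, hence of degree \<open>\<one>\<close>.\<close>

lemma bichar_nondegenerate:
  assumes t: "t \<in> T" and trivial: "\<And>u. u \<in> T \<Longrightarrow> \<beta> u t = 1"
  shows "t = \<one>"
proof -
  have "x * X t = X t * x" for x
  proof (rule linear_eq_on[of "\<lambda>x. x * X t" "\<lambda>x. X t * x" x "X ` T"])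
    show "linear (\<lambda>x. x * X t)" "linear (\<lambda>x. X t * x)"
      by (auto intro!: linearI simp: algebra_simps)
    show "x \<in> span (X ` T)"
      by (simp add: span_X)
    show "b * X t = X t * b" if b: "b \<in> X ` T" for b
    proof -
      obtain u where "u \<in> T" "b = X u"
        using b by blast
      then show ?thesis
        using bichar[of u t b "X t"] trivial[of u] X t by simp
    qed
  qed
  then have "f (X t) ** f x = f x ** f (X t)" for x
    by (simp flip: f_mult)
  then have "f (X t) ** B = B ** f (X t)" for B
    using bij_is_surj[OF f_bij] by (metis surjD)
  then obtain c where "f (X t) = c *\<^sub>R mat 1"
    using central_matrix_scalar by blast
  then have "f (X t) = f (c *\<^sub>R 1)"
    by (simp add: linear_scale[OF f_linear] f_one)
  then have "X t = c *\<^sub>R 1"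
    using f_inj by (rule injD[rotated])
  then have "X t \<in> D \<one>"
    using subspace_scale[OF component_subspace[OF one_closed] one_component] by simp
  then show ?thesis
    using components_disjoint[of t \<one> "X t"] X[OF t] support_carrier[OF t] by auto
qed

text \<open>The values of \<open>\<beta>\<close> are signs, so squares lie in the radical.\<close>

lemma support_square:
  assumes t: "t \<in> T"
  shows "t \<otimes> t = \<one>"
proof (rule bichar_nondegenerate[OF support_mult[OF t t]])
  fix u assume u: "u \<in> T"
  have "\<beta> u (t \<otimes> t) = \<beta> t u * \<beta> t u"
    using t u by (simp add: bichar_sym[of u] bichar_mult_left support_mult)
  then show "\<beta> u (t \<otimes> t) = 1"
    using bichar_sign[OF t u] by auto
qed

section \<open>The quadratic form of the grading\<close>

lemma quad_eqI:
  assumes t: "t \<in> T" and x: "x \<in> D t" "x \<noteq> 0" and eq: "x * x = r *\<^sub>R 1"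
  shows "\<mu> t = sgn r" "r \<noteq> 0"
proof -
  have "x * x \<noteq> 0"
    using homogeneous_mult_nonzero support_carrier t x by blast
  then show r: "r \<noteq> 0"
    using eq by auto
  \<comment> \<open>Nonzero elements of the line differ by a factor \<open>a\<close>, their squares
    by \<open>a * a\<close>, which is positive.\<close>
  have pos: "\<exists>q>0. y * y = (q * sgn r) *\<^sub>R 1" if y: "y \<in> D t" "y \<noteq> 0" for y
  proof -
    obtain a where a: "y = a *\<^sub>R x"
      using component_multiple[OF t x y(1)] .
    then have "y * y = (a * a * r) *\<^sub>R 1"
      by (simp add: eq mult.assoc)
    also have "a * a * r = a * a * \<bar>r\<bar> * sgn r"
      by (simp add: mult.assoc abs_mult_sgn)
    finally have "y * y = (a * a * \<bar>r\<bar> * sgn r) *\<^sub>R 1" .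
    moreover have "a * a * \<bar>r\<bar> > 0"
      using a y(2) r by (auto simp: zero_less_mult_iff)
    ultimately show ?thesis
      by blast
  qed
  have "(THE s. s \<in> {1, -1} \<and> (\<forall>x\<in>D t - {0}. \<exists>r>0. x * x = (r * s) *\<^sub>R (1::'a))) = sgn r"
  proof (rule the_equality)
    show "sgn r \<in> {1, -1} \<and> (\<forall>x\<in>D t - {0}. \<exists>q>0. x * x = (q * sgn r) *\<^sub>R (1::'a))"
      using pos r by (auto simp: sgn_if)
    fix s assume s: "s \<in> {1, -1} \<and> (\<forall>x\<in>D t - {0}. \<exists>r>0. x * x = (r * s) *\<^sub>R (1::'a))"
    then obtain q where q: "q > 0" "x * x = (q * s) *\<^sub>R (1::'a)"
      using x by blast
    have "r *\<^sub>R (1::'a) = (q * s) *\<^sub>R 1"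
      using eq q(2) by metis
    then have "r = q * s"
      by simp
    then have "sgn r = sgn s"
      using q(1) by (simp add: sgn_mult)
    then show "s = sgn r"
      using s by auto
  qed
  then show "\<mu> t = sgn r"
    using t by (simp add: grading_quad_def)
qed

lemma homogeneous_square:
  assumes t: "t \<in> T" and x: "x \<in> D t"
  shows "\<exists>r. x * x = r *\<^sub>R 1"
  using component_mult[OF support_carrier[OF t] support_carrier[OF t] x x] support_square[OF t]
    scalar_multiple_one by simp

lemma quad_sign:
  assumes t: "t \<in> T"
  shows "\<mu> t \<in> {1, -1}"
proof -
  obtain r where "X t * X t = r *\<^sub>R 1"
    using homogeneous_square X[OF t] t by blast
  then have "\<mu> t = sgn r" "r \<noteq> 0"
    using quad_eqI[OF t] X[OF t] by blast+
  then show ?thesis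
    by (cases "r > 0") simp_all
qed

lemma quad:
  assumes t: "t \<in> T" and x: "x \<in> D t" "x \<noteq> 0"
  shows "\<exists>r>0. x * x = (r * \<mu> t) *\<^sub>R 1"
proof -
  obtain r where r: "x * x = r *\<^sub>R 1"
    using homogeneous_square[OF t x(1)] by blast
  then have "x * x = (\<bar>r\<bar> * \<mu> t) *\<^sub>R 1"
    using quad_eqI(1)[OF t x r] by (simp add: abs_mult_sgn)
  then show ?thesis
    using quad_eqI(2)[OF t x r] zero_less_abs_iff by blast
qed

text \<open>Reordering the square of \<open>X u * X v\<close> into a product of two squares costs
  one swap, which contributes \<open>\<beta> u v\<close>.\<close>

lemma quad_mult:
  assumes u: "u \<in> T" and v: "v \<in> T"
  shows "\<mu> (u \<otimes> v) = \<mu> u * \<mu> v * \<beta> u v"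
proof -
  obtain q r where q: "q > 0" "X u * X u = (q * \<mu> u) *\<^sub>R 1" and r: "r > 0" "X v * X v = (r * \<mu> v) *\<^sub>R 1"
    using quad X u v by metis
  have "(X u * X v) * (X u * X v) = X u * (X v * X u) * X v"
    by (simp add: mult.assoc)
  also have "\<dots> = X u * (\<beta> u v *\<^sub>R (X u * X v)) * X v"
    using bichar[OF v u, of "X v" "X u"] X u v bichar_sym[OF u v] by simp
  also have "\<dots> = \<beta> u v *\<^sub>R ((X u * X u) * (X v * X v))"
    by (simp add: mult.assoc)
  also have "\<dots> = (q * r * (\<mu> u * \<mu> v * \<beta> u v)) *\<^sub>R 1"
    by (simp add: q r mult_ac)
  finally have "\<mu> (u \<otimes> v) = sgn (q * r * (\<mu> u * \<mu> v * \<beta> u v))"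
    using quad_eqI(1)[OF support_mult[OF u v]] X_mult[OF u v] by blast
  also have "\<dots> = \<mu> u * \<mu> v * \<beta> u v"
    using q r quad_sign[OF u] quad_sign[OF v] bichar_sign[OF u v] by (auto simp: sgn_mult)
  finally show ?thesis .
qed

lemma elementary_2_group_support: "elementary_2_group (support_group G D)"
  by (intro elementary_2_group.intro comm_group_support elementary_2_group_axioms.intro)
    (simp_all add: finite_support support_square)

lemma quadratic_space_support: "quadratic_space (support_group G D) \<beta> \<mu>"
  by (intro quadratic_space.intro elementary_2_group_support quadratic_space_axioms.intro)
    (simp_all add: bichar_sign[simplified] bichar_mult_left bichar_sym bichar_diag
      bichar_nondegenerate quad_sign[simplified] quad_mult)

sublocale Q: quadratic_space "support_group G D" "grading_bichar D" "grading_quad G D"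
  rewrites "carrier (support_group G D) = support G D"
    and "monoid.mult (support_group G D) = monoid.mult G"
    and "one (support_group G D) = one G"
  by (simp_all add: quadratic_space_support)

lemma linear_eq_on_basis:
  assumes Y: "homogeneous_basis Y" and lin: "linear g" "linear h"
    and eq: "\<And>t. t \<in> T \<Longrightarrow> g (Y t) = h (Y t)"
  shows "g x = h x"
proof (rule linear_eq_on[OF lin, of x "Y ` T"])
  show "x \<in> span (Y ` T)"
    by (simp add: homogeneous_basis_span[OF Y])
  show "g b = h b" if "b \<in> Y ` T" for b
    using that eq by blast
qed

lemma bilinear_eq_on_basis:
  assumes Y: "homogeneous_basis Y"
    and lin: "\<And>y. linear (\<lambda>x. g x y)" "\<And>x. linear (g x)"
      "\<And>y. linear (\<lambda>x. h x y)" "\<And>x. linear (h x)"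
    and eq: "\<And>u v. \<lbrakk>u \<in> T; v \<in> T\<rbrakk> \<Longrightarrow> g (Y u) (Y v) = h (Y u) (Y v)"
  shows "g x y = h x y"
proof (rule linear_eq_on_basis[OF Y lin(2) lin(4)])
  fix v assume v: "v \<in> T"
  show "g x (Y v) = h x (Y v)"
    by (rule linear_eq_on_basis[OF Y lin(1) lin(3)]) (rule eq[OF _ v])
qed

lemma linear_extend_basis:
  fixes z :: "'g \<Rightarrow> 'b::real_vector"
  assumes Y: "homogeneous_basis Y"
  obtains g where "linear g" "\<And>t. t \<in> T \<Longrightarrow> g (Y t) = z t"
proof -
  obtain g where g: "linear g" "\<forall>x\<in>Y ` T. g x = z (the_inv_into T Y x)"
    using linear_independent_extend[OF homogeneous_basis_independent[OF Y], of "\<lambda>x. z (the_inv_into T Y x)"]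
    by blast
  have "g (Y t) = z t" if t: "t \<in> T" for t
    using bspec[OF g(2) imageI[OF t]] the_inv_into_f_f[OF homogeneous_basis_inj[OF Y] t] by simp
  then show ?thesis
    by (rule that[OF g(1)])
qed

section \<open>Traces and the sum of \<open>\<mu>\<close>\<close>

lemma trace_component:
  assumes t: "t \<in> T" "t \<noteq> \<one>" and x: "x \<in> D t"
  shows "trace (f x) = 0"
proof -
  obtain w where w: "w \<in> T" "\<beta> t w = -1"
    using Q.exists_anticommuting[OF t] .
  obtain y where y: "X w * y = 1" "y * X w = 1"
    using homogeneous_inverse[OF support_carrier[OF w(1)]] X[OF w(1)] by metis
  \<comment> \<open>Conjugation by \<open>X w\<close> negates \<open>x\<close> but preserves the
    trace.\<close>
  have "x = x * X w * y"
    using y(1) by (simp add: mult.assoc)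
  also have "x * X w = - (X w * x)"
    using bichar[OF t(1) w(1) x, of "X w"] X[OF w(1)] w(2) by simp
  finally have "x = - (X w * (x * y))"
    by (simp add: mult.assoc)
  then have "f x = f (- (X w * (x * y)))"
    by (rule arg_cong)
  also have "\<dots> = - (f (X w) ** f (x * y))"
    by (simp only: linear_neg[OF f_linear] f_mult)
  finally have "f x = - (f (X w) ** f (x * y))" .
  then have "trace (f x) = - trace (f (X w) ** f (x * y))"
    by (simp add: linear_neg[OF linear_trace])
  also have "trace (f (X w) ** f (x * y)) = trace (f (x * y) ** f (X w))"
    by (rule trace_mul_sym)
  also have "f (x * y) ** f (X w) = f x"
    using y(2) by (simp add: mult.assoc flip: f_mult)
  finally show ?thesis
    by simp
qed

text \<open>Distinct components are orthogonal for the trace form, since distinct \<open>u\<close>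
  and \<open>v\<close> have a nontrivial product in exponent two.\<close>

lemma trace_product_component:
  assumes u: "u \<in> T" and v: "v \<in> T" and uv: "u \<noteq> v" and x: "x \<in> D u" and y: "y \<in> D v"
  shows "trace (f (x * y)) = 0"
proof (rule trace_component[OF support_mult[OF u v]])
  show "u \<otimes> v \<noteq> \<one>"
    using Q.mult_cancel_square[OF u v] uv support_carrier[OF u] by auto
  show "x * y \<in> D (u \<otimes> v)"
    by (rule component_mult[OF support_carrier[OF u] support_carrier[OF v] x y])
qed

lemma trace_square_component:
  assumes t: "t \<in> T" "\<mu> t = -1" and x: "x \<in> D t" "x \<noteq> 0"
  shows "trace (f (x * x)) < 0"
proof -
  obtain q where "q > 0" "x * x = (q * \<mu> t) *\<^sub>R 1"
    using quad[OF t(1) x] by blast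
  then show ?thesis
    by (simp add: t(2) linear_scale[OF f_linear] linear_scale[OF linear_trace]
        linear_neg[OF f_linear] linear_neg[OF linear_trace] f_one trace_I)
qed

text \<open>The trace form is negative definite on the span of the components with \<open>\<mu> = -1\<close>, so this
  span meets the symmetric matrices, more than half of the space, only in 0.\<close>

lemma sum_quad_pos: "(\<Sum>t\<in>T. \<mu> t) > 0"
proof -
  define N where "N = {t \<in> T. \<mu> t = -1}"
  have N: "N \<subseteq> T" "finite N"
    using finite_support by (auto simp: N_def)
  define W where "W = span ((\<lambda>t. f (X t)) ` N)"
  have "trace (x ** x) < 0" if x: "x \<in> W" "x \<noteq> 0" for x
  proof -
    obtain r where "x = (\<Sum>v\<in>(\<lambda>t. f (X t)) ` N. r v *\<^sub>R v)"
      using x(1) N(2) unfolding W_def by (auto simp: span_finite)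
    also have "\<dots> = (\<Sum>t\<in>N. r (f (X t)) *\<^sub>R f (X t))"
      using sum.reindex[OF inj_on_subset[OF inj_fX N(1)]] by simp
    also have "\<dots> = f (\<Sum>t\<in>N. r (f (X t)) *\<^sub>R X t)"
      by (simp add: linear_sum[OF f_linear] linear_scale[OF f_linear])
    finally have xf: "x = f (\<Sum>t\<in>N. r (f (X t)) *\<^sub>R X t)" .
    define z where "z t = r (f (X t)) *\<^sub>R X t" for t
    have z: "z t \<in> D t" if "t \<in> N" for t
      using that N(1) X subspace_scale[OF component_subspace[OF support_carrier]]
      by (auto simp: z_def)
    have xz: "x = f (\<Sum>t\<in>N. z t)"
      using xf by (simp add: z_def)
    have "trace (x ** x) = trace (f ((\<Sum>t\<in>N. z t) * (\<Sum>t\<in>N. z t)))"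
      by (simp only: xz f_mult)
    also have "\<dots> = (\<Sum>u\<in>N. \<Sum>v\<in>N. trace (f (z u * z v)))"
      by (simp add: sum_product linear_sum[OF f_linear] linear_sum[OF linear_trace])
    also have "\<dots> = (\<Sum>u\<in>N. \<Sum>v\<in>N. if u = v then trace (f (z v * z v)) else 0)"
    proof (intro sum.cong refl)
      fix u v assume uv: "u \<in> N" "v \<in> N"
      show "trace (f (z u * z v)) = (if u = v then trace (f (z v * z v)) else 0)"
        using trace_product_component[OF _ _ _ z[OF uv(1)] z[OF uv(2)]] uv N(1) by auto
    qed
    also have "\<dots> = (\<Sum>t\<in>N. trace (f (z t * z t)))"
      using N(2) by simp
    finally have tr: "trace (x ** x) = (\<Sum>t\<in>N. trace (f (z t * z t)))" .
    have neg: "trace (f (z t * z t)) < 0" if "t \<in> N" "z t \<noteq> 0" for t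
      using trace_square_component[of t "z t"] that z by (simp add: N_def)
    have "\<exists>t\<in>N. z t \<noteq> 0"
    proof (rule ccontr)
      assume "\<not> (\<exists>t\<in>N. z t \<noteq> 0)"
      then have "(\<Sum>t\<in>N. z t) = 0"
        by simp
      then show False
        using xz x(2) linear_0[OF f_linear] by simp
    qed
    then obtain s where s: "s \<in> N" "z s \<noteq> 0"
      by blast
    have "0 < (\<Sum>t\<in>N. - trace (f (z t * z t)))"
    proof (rule sum_pos2[OF N(2) s(1)])
      show "0 < - trace (f (z s * z s))"
        using neg[OF s] by simp
      show "0 \<le> - trace (f (z t * z t))" if "t \<in> N" for t
        using neg[OF that] linear_0[OF f_linear] linear_0[OF linear_trace[where 'n='n]] by (cases "z t = 0") simp_all
    qed
    then show ?thesis
      by (simp add: tr sum_negf)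
  qed
  then have "2 * dim W < CARD('n) * CARD('n)"
    by (intro dim_negative_trace_subspace) (simp_all add: W_def)
  moreover have "dim W = card N"
  proof -
    have "independent ((\<lambda>t. f (X t)) ` N)"
      using real_vector.independent_mono[OF independent_fX] N(1) by (simp add: image_image image_mono)
    then show ?thesis
      unfolding W_def dim_span
      using dim_eq_card_independent card_image[OF inj_on_subset[OF inj_fX N(1)]] by metis
  qed
  ultimately have card: "2 * card N < card T"
    by (simp add: card_support)
  \<comment> \<open>Each value -1 lowers the all-ones sum by 2, so the sum is
    \<open>card T - 2 * card N\<close>.\<close>
  have "(\<Sum>t\<in>T. \<mu> t) = (\<Sum>t\<in>T. 1 - (if \<mu> t = -1 then 2 else 0))"
    using quad_sign by (intro sum.cong) auto
  also have "\<dots> = real (card T) - (\<Sum>t\<in>N. 2)"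
    unfolding N_def by (simp add: sum_subtractf flip: sum.inter_filter[OF finite_support])
  finally show ?thesis
    using card by simp
qed

text \<open>As a divisor of a power of two, \<open>CARD('n)\<close> is one too;
  \<open>card T\<close> is its square.\<close>

lemma card_support_power: "\<exists>m. CARD('n) = 2 ^ m \<and> card T = 2 ^ (2 * m)"
proof -
  obtain k where k: "card T = 2 ^ k"
    using Q.card_carrier_power by blast
  then have "CARD('n) dvd 2 ^ k"
    using card_support by (metis dvd_triv_left)
  then obtain m where "CARD('n) = 2 ^ m"
    using divides_primepow_nat[OF two_is_prime_nat] by blast
  then show ?thesis
    using card_support by (auto simp: power_add mult_2)
qed

lemma quad_form: "\<mu> \<in> Q.forms"
  unfolding Q.forms_iff using quad_sign quad_mult by (simp add: grading_quad_def PiE_iff)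

section \<open>Involutions and their quadratic forms\<close>

lemma involution_form:
  assumes \<phi>: "graded_involution G D \<phi>"
  shows "\<exists>!\<eta>. \<eta> \<in> Q.forms \<and> acts_by G D \<phi> \<eta>"
proof -
  have lin: "linear \<phi>" and anti: "\<And>x y. \<phi> (x * y) = \<phi> y * \<phi> x" and invol: "\<And>x. \<phi> (\<phi> x) = x"
    and graded: "\<And>g x. \<lbrakk>g \<in> carrier G; x \<in> D g\<rbrakk> \<Longrightarrow> \<phi> x \<in> D g"
    using \<phi> unfolding graded_involution_def by blast+
  have "\<exists>r. \<phi> (X t) = r *\<^sub>R X t" if "t \<in> T" for t
    using graded[OF support_carrier[OF that], of "X t"] X[OF that] component_eq_X[OF that] by auto
  then obtain r where r: "\<And>t. t \<in> T \<Longrightarrow> \<phi> (X t) = r t *\<^sub>R X t"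
    by metis
  have act: "\<phi> x = r t *\<^sub>R x" if "t \<in> T" "x \<in> D t" for t x
    using that r component_eq_X[OF that(1)] by (auto simp: linear_scale[OF lin])
  have sign: "r t \<in> {1, -1}" if t: "t \<in> T" for t
  proof -
    have "(r t * r t) *\<^sub>R X t = 1 *\<^sub>R X t"
      using invol[of "X t"] by (simp add: r[OF t] linear_scale[OF lin])
    then have "r t * r t = 1"
      using X[OF t] scaleR_right_imp_eq by blast
    then show ?thesis
      by (simp add: square_eq_1_iff)
  qed
  \<comment> \<open>Reversing the product exchanges \<open>X u\<close> and \<open>X v\<close>, and
    undoing the exchange costs \<open>\<beta> u v\<close>: this is why the eigenvalues form a
    quadratic form instead of a character.\<close>
  have mult: "r (u \<otimes> v) = r u * r v * \<beta> u v" if u: "u \<in> T" and v: "v \<in> T" for u v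
  proof -
    have "r (u \<otimes> v) *\<^sub>R (X u * X v) = \<phi> (X u * X v)"
      using act[OF support_mult[OF u v]] X_mult[OF u v] by simp
    also have "\<dots> = (r u * r v) *\<^sub>R (X v * X u)"
      by (simp add: anti r u v mult.commute)
    also have "\<dots> = (r u * r v * \<beta> u v) *\<^sub>R (X u * X v)"
      using bichar[OF v u, of "X v" "X u"] X u v bichar_sym[OF u v] by simp
    finally show ?thesis
      using X_mult[OF u v] scaleR_right_imp_eq by blast
  qed
  have form: "restrict r T \<in> Q.forms"
    unfolding Q.forms_iff using sign mult by (simp add: support_mult)
  show ?thesis
  proof (intro ex1I conjI)
    show "restrict r T \<in> Q.forms"
      by (rule form)
    show "acts_by G D \<phi> (restrict r T)"
      using act by (simp add: acts_by_def)
    fix \<eta> assume \<eta>: "\<eta> \<in> Q.forms \<and> acts_by G D \<phi> \<eta>"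
    show "\<eta> = restrict r T"
    proof (rule PiE_ext)
      show "\<eta> \<in> T \<rightarrow>\<^sub>E {1, -1}" "restrict r T \<in> T \<rightarrow>\<^sub>E {1, -1}"
        using \<eta> form by (simp_all add: Q.forms_iff)
      fix t assume t: "t \<in> T"
      then have "\<eta> t *\<^sub>R X t = r t *\<^sub>R X t"
        using \<eta> X[OF t] r[OF t] by (auto simp: acts_by_def)
      then show "\<eta> t = restrict r T t"
        using X[OF t] t by simp
    qed
  qed
qed

lemma acts_by_unique:
  assumes "linear \<phi>" "linear \<phi>'" "acts_by G D \<phi> \<eta>" "acts_by G D \<phi>' \<eta>"
  shows "\<phi> = \<phi>'"
proof
  fix x show "\<phi> x = \<phi>' x"
    using linear_eq_on_basis[OF homogeneous_basis_X assms(1,2)] assms(3,4) X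
    by (simp add: acts_by_def)
qed

text \<open>The map is prescribed on a basis. There the product rule of \<open>\<eta>\<close>
  amounts to antimultiplicativity, and \<open>\<eta> t * \<eta> t = 1\<close> to
  involutivity.\<close>

lemma form_involution:
  assumes \<eta>: "\<eta> \<in> Q.forms"
  shows "\<exists>!\<phi>. graded_involution G D \<phi> \<and> acts_by G D \<phi> \<eta>"
proof -
  have mult: "\<eta> (u \<otimes> v) = \<eta> u * \<eta> v * \<beta> u v" if "u \<in> T" "v \<in> T" for u v
    using \<eta> that by (simp add: Q.forms_iff)
  have sign: "\<eta> t * \<eta> t = 1" if "t \<in> T" for t
    using Q.form_sign[OF \<eta> that] by auto
  obtain \<phi> where lin: "linear \<phi>" and \<phi>: "\<And>t. t \<in> T \<Longrightarrow> \<phi> (X t) = \<eta> t *\<^sub>R X t"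
    using linear_extend_basis[OF homogeneous_basis_X, of "\<lambda>t. \<eta> t *\<^sub>R X t"] by blast
  have act: "\<phi> x = \<eta> t *\<^sub>R x" if "t \<in> T" "x \<in> D t" for t x
    using that \<phi> component_eq_X[OF that(1)] by (auto simp: linear_scale[OF lin])
  have anti: "\<phi> (x * y) = \<phi> y * \<phi> x" for x y
  proof (rule bilinear_eq_on_basis[OF homogeneous_basis_X, of "\<lambda>x y. \<phi> (x * y)" "\<lambda>x y. \<phi> y * \<phi> x"])
    fix u v assume u: "u \<in> T" and v: "v \<in> T"
    have "\<phi> (X u * X v) = (\<eta> u * \<eta> v * \<beta> u v) *\<^sub>R (X u * X v)"
      using act[OF support_mult[OF u v]] X_mult[OF u v] mult[OF u v] by simp
    also have "\<dots> = (\<eta> u * \<eta> v) *\<^sub>R (X v * X u)"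
      using bichar[OF v u, of "X v" "X u"] X u v bichar_sym[OF u v] by simp
    also have "\<dots> = \<phi> (X v) * \<phi> (X u)"
      by (simp add: \<phi> u v mult.commute)
    finally show "\<phi> (X u * X v) = \<phi> (X v) * \<phi> (X u)" .
  qed (auto intro!: linearI simp: linear_add[OF lin] linear_scale[OF lin] algebra_simps)
  have invol: "\<phi> (\<phi> x) = x" for x
  proof (rule linear_eq_on_basis[OF homogeneous_basis_X, of "\<lambda>x. \<phi> (\<phi> x)" "\<lambda>x. x"])
    show "linear (\<lambda>x. \<phi> (\<phi> x))" "linear (\<lambda>x::'a. x)"
      by (auto intro!: linearI simp: linear_add[OF lin] linear_scale[OF lin])
    show "\<phi> (\<phi> (X t)) = X t" if "t \<in> T" for t
      using that sign by (simp add: \<phi> linear_scale[OF lin])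
  qed
  have "\<phi> ` D g \<subseteq> D g" if g: "g \<in> carrier G" for g
  proof (cases "g \<in> T")
    case True
    then show ?thesis
      using act subspace_scale[OF component_subspace[OF g]] by auto
  next
    case False
    then show ?thesis
      using component_outside[OF g] linear_0[OF lin] by simp
  qed
  then have "graded_involution G D \<phi>"
    using lin anti invol involuntory_imp_bij[of \<phi>] by (auto simp: graded_involution_def)
  moreover have "acts_by G D \<phi> \<eta>"
    using act by (simp add: acts_by_def)
  ultimately show ?thesis
    using acts_by_unique by (intro ex1I[of _ \<phi>]) (auto simp: graded_involution_def)
qed

lemma card_involutions: "card {\<phi>. graded_involution G D \<phi>} = card T"
proof -
  obtain F where F: "\<And>\<eta>. \<eta> \<in> Q.forms \<Longrightarrow> graded_involution G D (F \<eta>) \<and> acts_by G D (F \<eta>) \<eta>"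
    using form_involution by metis
  have "inj_on F Q.forms"
    using F involution_form by (metis inj_onI)
  moreover have "F ` Q.forms = {\<phi>. graded_involution G D \<phi>}"
    using F involution_form form_involution by blast
  ultimately show ?thesis
    using card_image[of F Q.forms] Q.card_forms by simp
qed

text \<open>Positive reals have square roots, so only the sign \<open>\<mu> t\<close> survives
  rescaling.\<close>

lemma normalized_homogeneous:
  assumes t: "t \<in> T"
  obtains x where "x \<in> D t" "x \<noteq> 0" "x * x = \<mu> t *\<^sub>R 1"
proof -
  obtain q where q: "q > 0" "X t * X t = (q * \<mu> t) *\<^sub>R 1"
    using quad[OF t] X[OF t] by blast
  let ?x = "(1 / sqrt q) *\<^sub>R X t"
  have "?x * ?x = \<mu> t *\<^sub>R 1"
    using q by (simp add: field_simps)
  moreover have "?x \<in> D t" "?x \<noteq> 0"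
    using X[OF t] q(1) subspace_scale[OF component_subspace[OF support_carrier[OF t]]] by simp_all
  ultimately show ?thesis
    using that by blast
qed

text \<open>Moving \<open>e\<close> past \<open>z\<close> costs \<open>\<beta> a k\<close>, and
  \<open>e * e\<close> costs \<open>\<mu> a\<close>. Hence the structure constants on an enlarged
  subgroup come from the old ones and from \<open>\<beta>\<close> and \<open>\<mu>\<close>
  alone.\<close>

lemma extend_products:
  assumes a: "a \<in> T" and e: "e \<in> D a" "e * e = \<mu> a *\<^sub>R 1" and k: "k \<in> T" "z \<in> D k"
    and eq: "y * z = s *\<^sub>R w"
  shows "y * (z * e) = s *\<^sub>R (w * e)"
    and "(y * e) * z = (\<beta> a k * s) *\<^sub>R (w * e)"
    and "(y * e) * (z * e) = (\<beta> a k * s * \<mu> a) *\<^sub>R w"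
proof -
  show "y * (z * e) = s *\<^sub>R (w * e)"
    by (simp add: eq flip: mult.assoc)
  have "(y * e) * z = y * (\<beta> a k *\<^sub>R (z * e))"
    using bichar[OF a k(1) e(1) k(2)] by (simp add: mult.assoc)
  also have "\<dots> = \<beta> a k *\<^sub>R ((y * z) * e)"
    by (simp add: mult.assoc)
  finally show *: "(y * e) * z = (\<beta> a k * s) *\<^sub>R (w * e)"
    by (simp add: eq)
  have "(y * e) * (z * e) = ((y * e) * z) * e"
    by (simp add: mult.assoc)
  also have "\<dots> = (\<beta> a k * s) *\<^sub>R (w * (e * e))"
    unfolding * by (simp add: mult.assoc)
  finally show "(y * e) * (z * e) = (\<beta> a k * s * \<mu> a) *\<^sub>R w"
    by (simp add: e(2))
qed

end

section \<open>Graded isomorphisms\<close>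

text \<open>Normalization fixes homogeneous elements only up to sign, and independent choices on the
  two sides could produce different sign patterns. The elements are therefore built in parallel by
  \<open>subgroup_induct\<close>; when \<open>a\<close> is adjoined, \<open>extend_products\<close>
  yields equal new constants because \<open>\<alpha>\<close> preserves \<open>\<mu>\<close> and with
  it \<open>\<beta>\<close>.\<close>

lemma common_structure_constants:
  fixes G (structure)
  assumes L: "matrix_division_grading G D f" and L': "matrix_division_grading G D' f'"
    and closed: "\<And>t. t \<in> support G D \<Longrightarrow> \<alpha> t \<in> support G D'"
    and hom: "\<And>u v. \<lbrakk>u \<in> support G D; v \<in> support G D\<rbrakk> \<Longrightarrow> \<alpha> (u \<otimes> v) = \<alpha> u \<otimes> \<alpha> v"
    and quad: "\<And>t. t \<in> support G D \<Longrightarrow> grading_quad G D' (\<alpha> t) = grading_quad G D t"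
  obtains Y Y' where
    "\<And>t. t \<in> support G D \<Longrightarrow> Y t \<in> D t \<and> Y t \<noteq> 0 \<and> Y' t \<in> D' (\<alpha> t) \<and> Y' t \<noteq> 0"
    "\<And>u v. \<lbrakk>u \<in> support G D; v \<in> support G D\<rbrakk> \<Longrightarrow>
       \<exists>s. Y u * Y v = s *\<^sub>R Y (u \<otimes> v) \<and> Y' u * Y' v = s *\<^sub>R Y' (u \<otimes> v)"
proof -
  interpret A: matrix_division_grading G D f by fact
  interpret B: matrix_division_grading G D' f' by fact
  define P where "P H \<longleftrightarrow> (\<exists>Y Y'. (\<forall>t\<in>H. Y t \<in> D t \<and> Y t \<noteq> 0 \<and> Y' t \<in> D' (\<alpha> t) \<and> Y' t \<noteq> 0) \<and>
      (\<forall>u\<in>H. \<forall>v\<in>H. \<exists>s. Y u * Y v = s *\<^sub>R Y (u \<otimes> v) \<and> Y' u * Y' v = s *\<^sub>R Y' (u \<otimes> v)))" for H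
  have bichar: "grading_bichar D' (\<alpha> u) (\<alpha> v) = grading_bichar D u v"
    if uv: "u \<in> support G D" "v \<in> support G D" for u v
    using A.Q.bichar_from_quad[OF uv] B.Q.bichar_from_quad[OF closed closed, OF uv]
    by (simp add: quad uv A.support_mult flip: hom[OF uv])
  have "P (support G D)"
  proof (rule A.Q.subgroup_induct)
    have "\<alpha> \<one> \<otimes> \<alpha> \<one> = \<alpha> \<one>"
      using hom[OF A.support_one A.support_one] by simp
    then have "\<alpha> \<one> = \<one>"
      using B.Q.square_one[OF closed[OF A.support_one]] by simp
    then show "P {\<one>}"
      unfolding P_def using A.one_component B.one_component
      by (intro exI[of _ "\<lambda>t. 1"]) (auto intro!: exI[of _ 1])
  next
    fix H a
    assume H: "subgroup H (support_group G D)" and a: "a \<in> support G D" "a \<notin> H" and "P H"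
    then obtain Y Y' where Y: "\<And>t. t \<in> H \<Longrightarrow> Y t \<in> D t" "\<And>t. t \<in> H \<Longrightarrow> Y t \<noteq> 0"
      "\<And>t. t \<in> H \<Longrightarrow> Y' t \<in> D' (\<alpha> t)" "\<And>t. t \<in> H \<Longrightarrow> Y' t \<noteq> 0"
      and prod: "\<And>u v. \<lbrakk>u \<in> H; v \<in> H\<rbrakk> \<Longrightarrow> \<exists>s. Y u * Y v = s *\<^sub>R Y (u \<otimes> v) \<and> Y' u * Y' v = s *\<^sub>R Y' (u \<otimes> v)"
      unfolding P_def by blast
    have HT: "h \<in> support G D" if "h \<in> H" for h
      using subgroup.subset[OF H] that by auto
    have HG: "h \<in> carrier G" if "h \<in> H" for h
      using A.support_carrier[OF HT[OF that]] .
    have Hm: "h \<otimes> k \<in> H" if "h \<in> H" "k \<in> H" for h k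
      using subgroup.m_closed[OF H that] by simp
    note aG = A.support_carrier[OF a(1)]
    obtain e where e: "e \<in> D a" "e \<noteq> 0" "e * e = grading_quad G D a *\<^sub>R 1"
      using A.normalized_homogeneous[OF a(1)] .
    obtain e' where e': "e' \<in> D' (\<alpha> a)" "e' \<noteq> 0" "e' * e' = grading_quad G D a *\<^sub>R 1"
      using B.normalized_homogeneous[OF closed[OF a(1)]] quad[OF a(1)] by metis
    \<comment> \<open>In the extension, an element outside \<open>H\<close> is some
      \<open>h \<otimes> a\<close>, and another factor \<open>a\<close> recovers \<open>h\<close>;
      so the second case reads \<open>Y h * e\<close>.\<close>
    define Z where "Z t = (if t \<in> H then Y t else Y (t \<otimes> a) * e)" for t
    define Z' where "Z' t = (if t \<in> H then Y' t else Y' (t \<otimes> a) * e')" for t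
    have notin: "h \<otimes> a \<notin> H" if "h \<in> H" for h
      using A.Q.subgroup_extend_inj[OF H a that] by blast
    have haa: "h \<otimes> a \<otimes> a = h" if "h \<in> H" for h
      using HG[OF that] aG A.Q.square_one[OF a(1)] by (simp add: A.m_assoc)
    have Z: "Z h = Y h" "Z' h = Y' h" "Z (h \<otimes> a) = Y h * e" "Z' (h \<otimes> a) = Y' h * e'" if "h \<in> H" for h
      using that notin[OF that] haa[OF that] by (simp_all add: Z_def Z'_def)
    have comp: "Z (h \<otimes> a) \<in> D (h \<otimes> a) \<and> Z (h \<otimes> a) \<noteq> 0 \<and>
        Z' (h \<otimes> a) \<in> D' (\<alpha> (h \<otimes> a)) \<and> Z' (h \<otimes> a) \<noteq> 0" if h: "h \<in> H" for h
      using A.component_mult[OF HG[OF h] aG Y(1)[OF h] e(1)]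
        A.homogeneous_mult_nonzero[OF HG[OF h] Y(1,2)[OF h] e(2)]
        B.component_mult[OF B.support_carrier B.support_carrier Y(3)[OF h] e'(1), OF closed closed, OF HT[OF h] a(1)]
        B.homogeneous_mult_nonzero[OF B.support_carrier Y(3,4)[OF h] e'(2), OF closed, OF HT[OF h]]
      by (simp add: Z h hom[OF HT[OF h] a(1)])
    have prods: "\<exists>s. Z u * Z v = s *\<^sub>R Z (u \<otimes> v) \<and> Z' u * Z' v = s *\<^sub>R Z' (u \<otimes> v)"
      if uv: "u = h \<or> u = h \<otimes> a" "v = k \<or> v = k \<otimes> a" and h: "h \<in> H" and k: "k \<in> H" for u v h k
    proof -
      obtain s where s: "Y h * Y k = s *\<^sub>R Y (h \<otimes> k)" "Y' h * Y' k = s *\<^sub>R Y' (h \<otimes> k)"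
        using prod[OF h k] by blast
      note E = A.extend_products[OF a(1) e(1,3) HT[OF k] Y(1)[OF k] s(1)]
      \<comment> \<open>Rewritten along \<open>\<alpha>\<close>, the constants on the second side
        are literally those in \<open>E\<close>.\<close>
      note E' = B.extend_products[OF closed[OF a(1)] e'(1) _ closed[OF HT[OF k]] Y(3)[OF k] s(2),
          unfolded quad[OF a(1)] bichar[OF a(1) HT[OF k]], OF e'(3)]
      have eqs: "h \<otimes> (k \<otimes> a) = h \<otimes> k \<otimes> a" "h \<otimes> a \<otimes> k = h \<otimes> k \<otimes> a" "h \<otimes> a \<otimes> (k \<otimes> a) = h \<otimes> k"
        using HG[OF h] HG[OF k] aG A.Q.mult_cancel_square[OF a(1) HT[OF Hm[OF h k]]] by (simp_all add: A.m_ac)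
      note Zs = Z[OF h] Z[OF k] Z[OF Hm[OF h k]]
      from uv show ?thesis
      proof (elim disjE)
        assume "u = h" "v = k"
        then show ?thesis
          using s Zs by auto
      next
        assume "u = h" "v = k \<otimes> a"
        then show ?thesis
          using E(1) E'(1) by (auto simp: Zs eqs)
      next
        assume "u = h \<otimes> a" "v = k"
        then show ?thesis
          using E(2) E'(2) by (auto simp: Zs eqs)
      next
        assume "u = h \<otimes> a" "v = k \<otimes> a"
        then show ?thesis
          using E(3) E'(3) by (auto simp: Zs eqs)
      qed
    qed
    let ?K = "H \<union> (\<lambda>h. h \<otimes> a) ` H"
    have "\<forall>t\<in>?K. Z t \<in> D t \<and> Z t \<noteq> 0 \<and> Z' t \<in> D' (\<alpha> t) \<and> Z' t \<noteq> 0"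
      using comp Y Z by (auto simp: Z)
    moreover have "\<forall>u\<in>?K. \<forall>v\<in>?K. \<exists>s. Z u * Z v = s *\<^sub>R Z (u \<otimes> v) \<and> Z' u * Z' v = s *\<^sub>R Z' (u \<otimes> v)"
    proof (intro ballI)
      fix u v assume "u \<in> ?K" "v \<in> ?K"
      then obtain h k where "h \<in> H" "u = h \<or> u = h \<otimes> a" "k \<in> H" "v = k \<or> v = k \<otimes> a"
        by blast
      then show "\<exists>s. Z u * Z v = s *\<^sub>R Z (u \<otimes> v) \<and> Z' u * Z' v = s *\<^sub>R Z' (u \<otimes> v)"
        using prods by blast
    qed
    ultimately show "P ?K"
      unfolding P_def by (intro exI[of _ Z] exI[of _ Z'] conjI)
  qed
  then obtain Y Y' where Y: "\<forall>t\<in>support G D. Y t \<in> D t \<and> Y t \<noteq> 0 \<and> Y' t \<in> D' (\<alpha> t) \<and> Y' t \<noteq> 0"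
    "\<forall>u\<in>support G D. \<forall>v\<in>support G D. \<exists>s. Y u * Y v = s *\<^sub>R Y (u \<otimes> v) \<and> Y' u * Y' v = s *\<^sub>R Y' (u \<otimes> v)"
    unfolding P_def by (elim exE conjE)
  show ?thesis
    by (rule that[OF bspec[OF Y(1)] bspec[OF bspec[OF Y(2)]]])
qed

lemma algebra_isoI:
  assumes lin: "linear \<psi>" and mult: "\<And>x y. \<psi> (x * y) = \<psi> x * \<psi> y"
    and inv: "\<And>x. \<xi> (\<psi> x) = x" "\<And>y. \<psi> (\<xi> y) = y"
  shows "algebra_iso \<psi>"
proof -
  \<comment> \<open>Unitality comes from surjectivity: \<open>\<xi> 1\<close> is a preimage of
    1.\<close>
  have "\<psi> (1 * \<xi> 1) = \<psi> 1 * \<psi> (\<xi> 1)"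
    by (rule mult)
  then have one: "\<psi> 1 = 1"
    by (simp add: inv(2))
  have "bij \<psi>"
    by (rule o_bij[of \<xi>]) (simp_all add: fun_eq_iff inv)
  then show ?thesis
    using lin mult one by (simp add: algebra_iso_def)
qed

text \<open>Sending one matched basis to the other is multiplicative because the constants agree;
  the same rule read backwards gives the inverse.\<close>

lemma graded_algebra_iso:
  fixes G (structure)
  assumes L: "matrix_division_grading G D f" and L': "matrix_division_grading G D' f'"
    and bij: "bij_betw \<alpha> (support G D) (support G D')"
    and hom: "\<And>u v. \<lbrakk>u \<in> support G D; v \<in> support G D\<rbrakk> \<Longrightarrow> \<alpha> (u \<otimes> v) = \<alpha> u \<otimes> \<alpha> v"
    and quad: "\<And>t. t \<in> support G D \<Longrightarrow> grading_quad G D' (\<alpha> t) = grading_quad G D t"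
  obtains \<psi> where "algebra_iso \<psi>" "\<And>t. t \<in> support G D \<Longrightarrow> \<psi> ` D t = D' (\<alpha> t)"
proof -
  interpret A: matrix_division_grading G D f by fact
  interpret B: matrix_division_grading G D' f' by fact
  let ?T = "support G D"
  have closed: "\<alpha> t \<in> support G D'" if "t \<in> ?T" for t
    using bij_betwE[OF bij] that by blast
  obtain Y Y' where Y: "\<And>t. t \<in> ?T \<Longrightarrow> Y t \<in> D t \<and> Y t \<noteq> 0 \<and> Y' t \<in> D' (\<alpha> t) \<and> Y' t \<noteq> 0"
    and prod: "\<And>u v. \<lbrakk>u \<in> ?T; v \<in> ?T\<rbrakk> \<Longrightarrow>
       \<exists>s. Y u * Y v = s *\<^sub>R Y (u \<otimes> v) \<and> Y' u * Y' v = s *\<^sub>R Y' (u \<otimes> v)"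
    using common_structure_constants[OF L L' closed hom quad] by metis
  define \<alpha>' where "\<alpha>' = the_inv_into ?T \<alpha>"
  have \<alpha>': "\<alpha>' (\<alpha> t) = t" if "t \<in> ?T" for t
    using the_inv_into_f_f[OF bij_betw_imp_inj_on[OF bij] that] by (simp add: \<alpha>'_def)
  have surj: "\<exists>t\<in>?T. s = \<alpha> t" if "s \<in> support G D'" for s
    using bij_betw_imp_surj_on[OF bij] that by blast
  have basis: "A.homogeneous_basis Y"
    unfolding A.homogeneous_basis_def using Y by simp
  \<comment> \<open>\<open>Y'\<close> is indexed by the degrees of \<open>D\<close>, whereas a
    homogeneous basis for \<open>D'\<close> is indexed by its own degrees; hence the detour through
    \<open>\<alpha>'\<close>.\<close>
  have basis': "B.homogeneous_basis (\<lambda>s. Y' (\<alpha>' s))"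
    unfolding B.homogeneous_basis_def
  proof
    fix s assume "s \<in> support G D'"
    then obtain t where "t \<in> ?T" "s = \<alpha> t"
      using surj by blast
    then show "Y' (\<alpha>' s) \<in> D' s \<and> Y' (\<alpha>' s) \<noteq> 0"
      using Y by (simp add: \<alpha>')
  qed
  obtain \<psi> where lin: "linear \<psi>" and \<psi>: "\<And>t. t \<in> ?T \<Longrightarrow> \<psi> (Y t) = Y' t"
    using A.linear_extend_basis[OF basis, of Y'] by blast
  obtain \<xi> where lin': "linear \<xi>" and \<xi>0: "\<And>s. s \<in> support G D' \<Longrightarrow> \<xi> (Y' (\<alpha>' s)) = Y (\<alpha>' s)"
    using B.linear_extend_basis[OF basis', of "\<lambda>s. Y (\<alpha>' s)"] by blast
  have \<xi>: "\<xi> (Y' t) = Y t" if "t \<in> ?T" for t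
    using \<xi>0[OF closed[OF that]] by (simp add: \<alpha>' that)
  have 1: "\<xi> (\<psi> x) = x" for x
  proof (rule A.linear_eq_on_basis[OF basis, of "\<lambda>x. \<xi> (\<psi> x)" "\<lambda>x. x"])
    show "linear (\<lambda>x. \<xi> (\<psi> x))"
      using linear_compose[OF lin lin'] by (simp add: o_def)
  qed (simp_all add: \<psi> \<xi> linear_id[unfolded id_def])
  have 2: "\<psi> (\<xi> y) = y" for y
  proof (rule B.linear_eq_on_basis[OF basis', of "\<lambda>y. \<psi> (\<xi> y)" "\<lambda>y. y"])
    show "linear (\<lambda>x. \<psi> (\<xi> x))"
      using linear_compose[OF lin' lin] by (simp add: o_def)
    fix s assume "s \<in> support G D'"
    then obtain t where "t \<in> ?T" "s = \<alpha> t"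
      using surj by blast
    then show "\<psi> (\<xi> (Y' (\<alpha>' s))) = Y' (\<alpha>' s)"
      by (simp add: \<alpha>' \<psi> \<xi>)
  qed (simp add: linear_id[unfolded id_def])
  have mult: "\<psi> (x * y) = \<psi> x * \<psi> y" for x y
  proof (rule A.bilinear_eq_on_basis[OF basis, of "\<lambda>x y. \<psi> (x * y)" "\<lambda>x y. \<psi> x * \<psi> y"])
    fix u v assume u: "u \<in> ?T" and v: "v \<in> ?T"
    obtain s where "Y u * Y v = s *\<^sub>R Y (u \<otimes> v)" "Y' u * Y' v = s *\<^sub>R Y' (u \<otimes> v)"
      using prod[OF u v] by blast
    then show "\<psi> (Y u * Y v) = \<psi> (Y u) * \<psi> (Y v)"
      by (simp add: \<psi> u v A.support_mult linear_scale[OF lin])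
  qed (auto intro!: linearI simp: linear_add[OF lin] linear_scale[OF lin] algebra_simps)
  have "\<psi> ` D t = D' (\<alpha> t)" if t: "t \<in> ?T" for t
  proof -
    have "D t = range (\<lambda>r. r *\<^sub>R Y t)" "D' (\<alpha> t) = range (\<lambda>r. r *\<^sub>R Y' t)"
      using A.component_eq[OF t] B.component_eq[OF closed[OF t]] Y[OF t] by blast+
    then show ?thesis
      by (simp add: image_image linear_scale[OF lin] \<psi>[OF t])
  qed
  then show ?thesis
    using algebra_isoI[OF lin mult 1 2] by (rule that[rotated])
qed

text \<open>A normalized element and its image have squares given by the same scalar, and
  intertwining equates their eigenvalues. Separate degrees \<open>t\<close> and \<open>s\<close>
  serve both isomorphisms, with \<open>s = t\<close>, and equivalences, with \<open>s\<close> the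
  image degree.\<close>

lemma algebra_iso_invariants:
  fixes G (structure)
  assumes L: "matrix_division_grading G D f" and L': "matrix_division_grading G D' f'"
    and \<psi>: "algebra_iso \<psi>" and t: "t \<in> support G D" and s: "s \<in> support G D'"
    and image: "\<psi> ` D t \<subseteq> D' s"
  shows "grading_quad G D' s = grading_quad G D t"
    and "\<lbrakk>\<phi>' \<circ> \<psi> = \<psi> \<circ> \<phi>; acts_by G D \<phi> \<eta>; acts_by G D' \<phi>' \<eta>'\<rbrakk> \<Longrightarrow> \<eta>' s = \<eta> t"
proof -
  interpret A: matrix_division_grading G D f by fact
  interpret B: matrix_division_grading G D' f' by fact
  have lin: "linear \<psi>" and inj: "inj \<psi>" and mult: "\<And>x y. \<psi> (x * y) = \<psi> x * \<psi> y" and one: "\<psi> 1 = 1"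
    using \<psi> by (simp_all add: algebra_iso_def bij_def)
  obtain x where x: "x \<in> D t" "x \<noteq> 0" "x * x = grading_quad G D t *\<^sub>R 1"
    using A.normalized_homogeneous[OF t] .
  have y: "\<psi> x \<in> D' s"
    using image x(1) by blast
  have y0: "\<psi> x \<noteq> 0"
    using x(2) linear_injective_0[OF lin] inj by blast
  have "\<psi> x * \<psi> x = \<psi> (grading_quad G D t *\<^sub>R 1)"
    by (simp only: x(3) flip: mult)
  also have "\<dots> = grading_quad G D t *\<^sub>R 1"
    by (simp only: linear_scale[OF lin] one)
  finally have "grading_quad G D' s = sgn (grading_quad G D t)"
    by (rule B.quad_eqI(1)[OF s y y0])
  then show "grading_quad G D' s = grading_quad G D t"
    using A.quad_sign[OF t] by auto
  show "\<eta>' s = \<eta> t" if "\<phi>' \<circ> \<psi> = \<psi> \<circ> \<phi>" "acts_by G D \<phi> \<eta>" "acts_by G D' \<phi>' \<eta>'"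
  proof -
    have "\<eta>' s *\<^sub>R \<psi> x = \<phi>' (\<psi> x)"
      using that(3) s y by (simp add: acts_by_def)
    also have "\<dots> = \<psi> (\<phi> x)"
      by (rule fun_cong[OF that(1), unfolded comp_def])
    also have "\<dots> = \<eta> t *\<^sub>R \<psi> x"
      using that(2) t x(1) by (simp add: acts_by_def linear_scale[OF lin])
    finally show ?thesis
      using y0 by simp
  qed
qed

text \<open>On the component of degree \<open>t\<close> both composites are \<open>\<psi>\<close>
  followed by the scalar \<open>\<eta> t\<close>.\<close>

lemma graded_iso_intertwines:
  fixes G (structure)
  assumes L: "matrix_division_grading G D f" and \<psi>: "linear \<psi>" and \<phi>: "linear \<phi>" "linear \<phi>'"
    and act: "acts_by G D \<phi> \<eta>" "acts_by G D' \<phi>' \<eta>'"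
    and image: "\<And>t. t \<in> support G D \<Longrightarrow> \<alpha> t \<in> support G D' \<and> \<psi> ` D t = D' (\<alpha> t) \<and> \<eta>' (\<alpha> t) = \<eta> t"
  shows "\<phi>' \<circ> \<psi> = \<psi> \<circ> \<phi>"
proof
  interpret A: matrix_division_grading G D f by fact
  fix x
  show "(\<phi>' \<circ> \<psi>) x = (\<psi> \<circ> \<phi>) x"
  proof (rule A.linear_eq_on_basis[OF A.homogeneous_basis_X linear_compose linear_compose])
    fix t assume t: "t \<in> support G D"
    have "\<psi> (A.X t) \<in> D' (\<alpha> t)"
      using image[OF t] A.X[OF t] by blast
    then have "\<phi>' (\<psi> (A.X t)) = \<eta>' (\<alpha> t) *\<^sub>R \<psi> (A.X t)"
      using act(2) image[OF t] unfolding acts_by_def by blast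
    then show "(\<phi>' \<circ> \<psi>) (A.X t) = (\<psi> \<circ> \<phi>) (A.X t)"
      using act(1) image[OF t] A.X[OF t] t by (simp add: acts_by_def linear_scale[OF \<psi>])
  qed (use \<psi> \<phi> in simp_all)
qed

text \<open>An isomorphism keeps every degree, so the invariants are compared degree by degree;
  conversely the identity of the support lifts to the algebras. The \<open>ext\<close> hypotheses
  turn agreement on the support into equality of functions.\<close>

lemma isomorphic_pairs_iff:
  fixes G (structure)
  assumes L: "matrix_division_grading G D f" and L': "matrix_division_grading G D' f'"
    and \<phi>: "graded_involution G D \<phi>" "graded_involution G D' \<phi>'"
    and act: "acts_by G D \<phi> \<eta>" "acts_by G D' \<phi>' \<eta>'"
    and ext: "\<eta> \<in> extensional (support G D)" "\<eta>' \<in> extensional (support G D')"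
  shows "isomorphic_pairs G D \<phi> D' \<phi>' \<longleftrightarrow>
    support G D = support G D' \<and> grading_quad G D = grading_quad G D' \<and> \<eta> = \<eta>'" (is "?L \<longleftrightarrow> ?R")
proof
  interpret A: matrix_division_grading G D f by fact
  interpret B: matrix_division_grading G D' f' by fact
  {
    assume ?L
    then obtain \<psi> where \<psi>: "algebra_iso \<psi>" and comm: "\<phi>' \<circ> \<psi> = \<psi> \<circ> \<phi>"
      and image: "\<And>g. g \<in> carrier G \<Longrightarrow> \<psi> ` D g = D' g"
      unfolding isomorphic_pairs_def by blast
    have lin: "linear \<psi>" and inj: "inj \<psi>"
      using \<psi> by (simp_all add: algebra_iso_def bij_def)
    have "D g = {0} \<longleftrightarrow> D' g = {0}" if "g \<in> carrier G" for g
    proof -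
      have "\<psi> ` D g = \<psi> ` {0} \<longleftrightarrow> D g = {0}"
        by (rule inj_image_eq_iff[OF inj])
      then show ?thesis
        by (simp add: image[OF that] linear_0[OF lin])
    qed
    then have supp: "support G D = support G D'"
      by (auto simp: support_def)
    have "grading_quad G D t = grading_quad G D' t \<and> \<eta> t = \<eta>' t" if t: "t \<in> support G D" for t
    proof -
      have s: "t \<in> support G D'" "\<psi> ` D t \<subseteq> D' t"
        using t image[OF A.support_carrier[OF t]] by (simp_all add: supp)
      show ?thesis
        using algebra_iso_invariants(1)[OF L L' \<psi> t s]
          algebra_iso_invariants(2)[OF L L' \<psi> t s comm act] by simp
    qed
    moreover have "grading_quad G D \<in> extensional (support G D)" "grading_quad G D' \<in> extensional (support G D')"
      by (simp_all add: grading_quad_def)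
    ultimately show ?R
      using supp ext by (auto intro: extensionalityI)
  }
  assume R: ?R
  have "bij_betw (\<lambda>t. t) (support G D) (support G D')"
    using R by (simp add: bij_betw_def)
  then obtain \<psi> where \<psi>: "algebra_iso \<psi>" and image: "\<And>t. t \<in> support G D \<Longrightarrow> \<psi> ` D t = D' t"
    using graded_algebra_iso[OF L L', of "\<lambda>t. t"] R by auto
  have lin: "linear \<psi>"
    using \<psi> by (simp add: algebra_iso_def)
  have "\<phi>' \<circ> \<psi> = \<psi> \<circ> \<phi>"
    using graded_iso_intertwines[OF L lin _ _ act, of "\<lambda>t. t"] \<phi> image R
    by (simp add: graded_involution_def)
  \<comment> \<open>Isomorphism also constrains the degrees outside the support, where both
    components vanish.\<close>
  moreover have "\<psi> ` D g = D' g" if g: "g \<in> carrier G" for g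
  proof (cases "g \<in> support G D")
    case False
    then have "D g = {0}" "D' g = {0}"
      using g R A.component_outside B.component_outside by simp_all
    then show ?thesis
      by (simp add: linear_0[OF lin])
  qed (rule image)
  ultimately show ?L
    unfolding isomorphic_pairs_def using \<psi> by blast
qed

section \<open>Equivalence and the three classes\<close>

context matrix_division_grading
begin

lemma Arf_quad: "Arf (support_group G D) \<mu> = 1"
  using Arf_eq_sum[of "support_group G D" \<mu>] sum_quad_pos finite_support quad_sign by simp

text \<open>Injectivity of \<open>\<psi>\<close> and finiteness of the support make the map on
  degrees a permutation of \<open>T\<close> that preserves \<open>\<mu>\<close> and carries
  \<open>\<eta>\<close> to \<open>\<eta>'\<close>. Conversely, an isometry with this property lifts
  to an isomorphism permuting the components.\<close>

lemma equivalent_pairs_iff: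
  assumes \<phi>: "graded_involution G D \<phi>" "graded_involution G D \<phi>'"
    and \<eta>: "\<eta> \<in> Q.forms" "\<eta>' \<in> Q.forms"
    and act: "acts_by G D \<phi> \<eta>" "acts_by G D \<phi>' \<eta>'"
  shows "equivalent_pairs G D \<phi> G D \<phi>' \<longleftrightarrow> Q.same_class \<eta> \<eta>'"
proof
  note L = matrix_division_grading_axioms
  assume "equivalent_pairs G D \<phi> G D \<phi>'"
  then obtain \<psi> where \<psi>: "algebra_iso \<psi>" and comm: "\<phi>' \<circ> \<psi> = \<psi> \<circ> \<phi>"
    and "\<forall>g\<in>T. \<exists>h\<in>carrier G. \<psi> ` D g = D h"
    unfolding equivalent_pairs_def by blast
  then obtain \<alpha> where \<alpha>: "\<And>g. g \<in> T \<Longrightarrow> \<alpha> g \<in> carrier G \<and> \<psi> ` D g = D (\<alpha> g)"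
    by metis
  have lin: "linear \<psi>" and inj: "inj \<psi>"
    using \<psi> by (simp_all add: algebra_iso_def bij_def)
  have closed: "\<alpha> t \<in> T" if t: "t \<in> T" for t
  proof -
    have "D t \<noteq> {0}"
      using t by (simp add: support_def)
    then have "\<psi> ` D t \<noteq> \<psi> ` {0}"
      by (simp only: inj_image_eq_iff[OF inj] not_False_eq_True)
    then show ?thesis
      using \<alpha>[OF t] by (simp add: support_def linear_0[OF lin])
  qed
  have "inj_on \<alpha> T"
  proof (rule inj_onI)
    fix u v assume u: "u \<in> T" and v: "v \<in> T" and "\<alpha> u = \<alpha> v"
    then have "\<psi> ` D u = \<psi> ` D v"
      using \<alpha> by metis
    then have "D u = D v"
      using inj_image_eq_iff[OF inj] by blast
    then show "u = v"
      using components_disjoint[OF support_carrier[OF u] support_carrier[OF v], of "X u"] X[OF u] by blast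
  qed
  moreover have "\<alpha> ` T \<subseteq> T"
    using closed by blast
  ultimately have bij: "bij_betw \<alpha> T T"
    unfolding bij_betw_def using endo_inj_surj[OF finite_support] by blast
  have inv: "\<mu> (\<alpha> t) = \<mu> t" "\<eta>' (\<alpha> t) = \<eta> t" if "t \<in> T" for t
    using algebra_iso_invariants[OF L L \<psi> that closed[OF that]] \<alpha>[OF that] comm act by simp_all
  show "Q.same_class \<eta> \<eta>'"
    by (rule Q.bijection_same_class[OF quad_form sum_quad_pos \<eta> bij inv])
next
  note L = matrix_division_grading_axioms
  assume "Q.same_class \<eta> \<eta>'"
  then obtain \<alpha> where iso: "Q.isometry \<alpha>" and eq: "\<And>t. t \<in> T \<Longrightarrow> \<eta>' (\<alpha> t) = \<eta> t"
    using Q.same_class_isometry[OF quad_form sum_quad_pos \<eta>] by blast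
  have hom: "\<alpha> (u \<otimes> v) = \<alpha> u \<otimes> \<alpha> v" if "u \<in> T" "v \<in> T" for u v
    using iso that hom_mult[of \<alpha> "support_group G D" "support_group G D" u v] by (simp add: Q.isometry_def)
  have bij: "bij_betw \<alpha> T T" and quad: "\<And>t. t \<in> T \<Longrightarrow> \<mu> (\<alpha> t) = \<mu> t"
    using iso by (simp_all add: Q.isometry_def)
  obtain \<psi> where \<psi>: "algebra_iso \<psi>" and image: "\<And>t. t \<in> T \<Longrightarrow> \<psi> ` D t = D (\<alpha> t)"
    using graded_algebra_iso[OF L L bij hom quad] by blast
  have closed: "\<alpha> t \<in> T" if "t \<in> T" for t
    using bij_betwE[OF bij] that by blast
  have "\<phi>' \<circ> \<psi> = \<psi> \<circ> \<phi>"
  proof (rule graded_iso_intertwines[OF L _ _ _ act])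
    show "linear \<psi>" "linear \<phi>" "linear \<phi>'"
      using \<psi> \<phi> by (simp_all add: algebra_iso_def graded_involution_def)
    show "\<alpha> t \<in> T \<and> \<psi> ` D t = D (\<alpha> t) \<and> \<eta>' (\<alpha> t) = \<eta> t" if "t \<in> T" for t
      using closed image eq that by simp
  qed
  then show "equivalent_pairs G D \<phi> G D \<phi>'"
    unfolding equivalent_pairs_def using \<psi> image closed support_carrier by blast
qed

end

text \<open>The isomorphism clause lets the second grading live on another algebra, of type
  \<open>'b\<close>, since being determined up to isomorphism compares all such pairs; the support
  is part of the data compared. The bijective correspondence is expressed by unique existence in
  both directions.\<close>

theorem mainTheorem7:
  fixes G :: "('g, 'c) monoid_scheme"
    and D :: "'g \<Rightarrow> 'a::real_algebra_1 set"
    and f :: "'a \<Rightarrow> real^'n^'n"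
  assumes G: "comm_group G"
    and f: "matrix_algebra_iso f"
    and D: "one_dim_division_grading G D"
  shows
    "let T = support_group G D;
         \<beta> = grading_bichar D;
         \<mu> = grading_quad G D;
         Q = quadratic_forms_with_polarization T \<beta>
     in
     subgroup (support G D) G \<and>
     (\<exists>m. CARD('n) = 2 ^ m \<and>
          T \<cong> product_group {..<2 * m} (\<lambda>_. integer_mod_group 2) \<and>
          card {\<phi>. graded_involution G D \<phi>} = 2 ^ (2 * m)) \<and>
     (\<forall>u\<in>carrier T. \<forall>v\<in>carrier T.
          \<beta> u v \<in> {1, -1} \<and>
          (\<forall>x\<in>D u - {0}. \<forall>y\<in>D v - {0}. x * y = \<beta> u v *\<^sub>R (y * x))) \<and>
     alternating_bicharacter T \<beta> \<and> type_I T \<beta> \<and>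
     (\<forall>t\<in>carrier T. \<forall>x\<in>D t - {0}. \<exists>r>0. x * x = (r * \<mu> t) *\<^sub>R 1) \<and>
     \<mu> \<in> Q \<and> Arf T \<mu> = 1 \<and>
     (\<forall>\<phi>. graded_involution G D \<phi> \<longrightarrow> (\<exists>!\<eta>. \<eta> \<in> Q \<and> acts_by G D \<phi> \<eta>)) \<and>
     (\<forall>\<eta>\<in>Q. \<exists>!\<phi>. graded_involution G D \<phi> \<and> acts_by G D \<phi> \<eta>) \<and>
     (\<forall>(D' :: 'g \<Rightarrow> 'b::real_algebra_1 set) (f' :: 'b \<Rightarrow> real^'k^'k) \<phi> \<phi>' \<eta> \<eta>'.
          matrix_algebra_iso f' \<and> one_dim_division_grading G D' \<and>
          graded_involution G D \<phi> \<and> \<eta> \<in> Q \<and> acts_by G D \<phi> \<eta> \<and>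
          graded_involution G D' \<phi>' \<and>
          \<eta>' \<in> quadratic_forms_with_polarization (support_group G D') (grading_bichar D') \<and>
          acts_by G D' \<phi>' \<eta>' \<longrightarrow>
          (isomorphic_pairs G D \<phi> D' \<phi>' \<longleftrightarrow>
           support G D = support G D' \<and> \<mu> = grading_quad G D' \<and> \<eta> = \<eta>')) \<and>
     (\<forall>\<phi> \<phi>'. graded_involution G D \<phi> \<and> graded_involution G D \<phi>' \<and> \<phi> \<noteq> \<phi>' \<longrightarrow>
          \<not> isomorphic_pairs G D \<phi> D \<phi>') \<and>
     (\<forall>\<phi> \<phi>' \<eta> \<eta>'.
          graded_involution G D \<phi> \<and> \<eta> \<in> Q \<and> acts_by G D \<phi> \<eta> \<and>
          graded_involution G D \<phi>' \<and> \<eta>' \<in> Q \<and> acts_by G D \<phi>' \<eta>' \<longrightarrow>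
          (equivalent_pairs G D \<phi> G D \<phi>' \<longleftrightarrow>
           (\<exists>S \<in> {{\<mu>}, {\<kappa> \<in> Q. Arf T \<kappa> = 1 \<and> \<kappa> \<noteq> \<mu>}, {\<kappa> \<in> Q. Arf T \<kappa> = -1}}.
              \<eta> \<in> S \<and> \<eta>' \<in> S)))"
proof -
  have loc: "matrix_division_grading G D f"
    by (simp add: matrix_division_grading_def matrix_division_grading_axioms_def G f D)
  interpret L: matrix_division_grading G D f
    by (rule loc)
  have forms_ext: "\<eta> \<in> extensional (support G D)" if "\<eta> \<in> L.Q.forms" for \<eta>
    using that by (simp add: L.Q.forms_iff PiE_def)
  \<comment> \<open>The types \<open>'d\<close> and \<open>'l\<close> are local and become generic:
    \<open>not_iso\<close> uses the fact on the given algebra, \<open>iso_iff_all\<close> on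
    algebras of type \<open>'b\<close>.\<close>
  have iso_iff: "isomorphic_pairs G D \<phi> D' \<phi>' \<longleftrightarrow>
      support G D = support G D' \<and> grading_quad G D = grading_quad G D' \<and> \<eta> = \<eta>'"
    if f': "matrix_algebra_iso f'" and D': "one_dim_division_grading G D'"
      and \<phi>: "graded_involution G D \<phi>" "\<eta> \<in> L.Q.forms" "acts_by G D \<phi> \<eta>"
      and \<phi>': "graded_involution G D' \<phi>'"
        "\<eta>' \<in> quadratic_forms_with_polarization (support_group G D') (grading_bichar D')"
        "acts_by G D' \<phi>' \<eta>'"
    for D' :: "'g \<Rightarrow> 'd::real_algebra_1 set" and f' :: "'d \<Rightarrow> real^'l^'l" and \<phi> \<phi>' \<eta> \<eta>'
  proof -
    have loc': "matrix_division_grading G D' f'"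
      by (simp add: matrix_division_grading_def matrix_division_grading_axioms_def G f' D')
    interpret L': matrix_division_grading G D' f'
      by (rule loc')
    have "\<eta>' \<in> extensional (support G D')"
      using \<phi>'(2) by (simp add: L'.Q.forms_iff PiE_def)
    then show ?thesis
      using isomorphic_pairs_iff[OF loc loc' \<phi>(1) \<phi>'(1) \<phi>(3) \<phi>'(3) forms_ext[OF \<phi>(2)]] by simp
  qed
  have not_iso: "\<not> isomorphic_pairs G D \<phi> D \<phi>'"
    if \<phi>: "graded_involution G D \<phi>" "graded_involution G D \<phi>'" "\<phi> \<noteq> \<phi>'" for \<phi> \<phi>'
  proof
    assume iso: "isomorphic_pairs G D \<phi> D \<phi>'"
    obtain \<eta> \<eta>' where \<eta>: "\<eta> \<in> L.Q.forms" "acts_by G D \<phi> \<eta>" "\<eta>' \<in> L.Q.forms" "acts_by G D \<phi>' \<eta>'"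
      using L.involution_form[OF \<phi>(1)] L.involution_form[OF \<phi>(2)] by blast
    then have "\<eta> = \<eta>'"
      using iso_iff[OF f D \<phi>(1) \<eta>(1,2) \<phi>(2) \<eta>(3,4)] iso by simp
    then show False
      using L.acts_by_unique[of \<phi> \<phi>' \<eta>] \<eta> \<phi> by (simp add: graded_involution_def)
  qed
  have power: "\<exists>m. CARD('n) = 2 ^ m \<and>
      support_group G D \<cong> product_group {..<2 * m} (\<lambda>_. integer_mod_group 2) \<and>
      card {\<phi>. graded_involution G D \<phi>} = 2 ^ (2 * m)"
    using L.card_support_power L.Q.iso_bit_vectors L.card_involutions by metis
  have commutation: "\<forall>u\<in>support G D. \<forall>v\<in>support G D. grading_bichar D u v \<in> {1, -1} \<and>
      (\<forall>x\<in>D u - {0}. \<forall>y\<in>D v - {0}. x * y = grading_bichar D u v *\<^sub>R (y * x))"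
    using L.bichar_sign L.bichar by blast
  have square: "\<forall>t\<in>support G D. \<forall>x\<in>D t - {0}. \<exists>r>0. x * x = (r * grading_quad G D t) *\<^sub>R 1"
    using L.quad by blast
  have iso_iff_all: "\<forall>(D' :: 'g \<Rightarrow> 'b::real_algebra_1 set) (f' :: 'b \<Rightarrow> real^'k^'k) \<phi> \<phi>' \<eta> \<eta>'.
      matrix_algebra_iso f' \<and> one_dim_division_grading G D' \<and>
      graded_involution G D \<phi> \<and> \<eta> \<in> L.Q.forms \<and> acts_by G D \<phi> \<eta> \<and>
      graded_involution G D' \<phi>' \<and>
      \<eta>' \<in> quadratic_forms_with_polarization (support_group G D') (grading_bichar D') \<and>
      acts_by G D' \<phi>' \<eta>' \<longrightarrow>
      (isomorphic_pairs G D \<phi> D' \<phi>' \<longleftrightarrow>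
       support G D = support G D' \<and> grading_quad G D = grading_quad G D' \<and> \<eta> = \<eta>')"
    by (intro allI impI, elim conjE, rule iso_iff)
  have not_iso_all: "\<forall>\<phi> \<phi>'. graded_involution G D \<phi> \<and> graded_involution G D \<phi>' \<and> \<phi> \<noteq> \<phi>' \<longrightarrow>
      \<not> isomorphic_pairs G D \<phi> D \<phi>'"
    using not_iso by blast
  have equiv: "\<forall>\<phi> \<phi>' \<eta> \<eta>'.
      graded_involution G D \<phi> \<and> \<eta> \<in> L.Q.forms \<and> acts_by G D \<phi> \<eta> \<and>
      graded_involution G D \<phi>' \<and> \<eta>' \<in> L.Q.forms \<and> acts_by G D \<phi>' \<eta>' \<longrightarrow>
      (equivalent_pairs G D \<phi> G D \<phi>' \<longleftrightarrow>
       (\<exists>S \<in> {{grading_quad G D},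
           {\<kappa> \<in> L.Q.forms. Arf (support_group G D) \<kappa> = 1 \<and> \<kappa> \<noteq> grading_quad G D},
           {\<kappa> \<in> L.Q.forms. Arf (support_group G D) \<kappa> = -1}}. \<eta> \<in> S \<and> \<eta>' \<in> S))"
    unfolding L.Q.same_class_def[symmetric] using L.equivalent_pairs_iff by blast
  have involutions: "\<forall>\<phi>. graded_involution G D \<phi> \<longrightarrow> (\<exists>!\<eta>. \<eta> \<in> L.Q.forms \<and> acts_by G D \<phi> \<eta>)"
    and forms: "\<forall>\<eta>\<in>L.Q.forms. \<exists>!\<phi>. graded_involution G D \<phi> \<and> acts_by G D \<phi> \<eta>"
    using L.involution_form L.form_involution by simp_all
  have carrier: "carrier (support_group G D) = support G D"
    by simp
  show ?thesis
    unfolding Let_def carrier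
    using L.subgroup_support power commutation L.Q.alternating_bicharacter L.Q.type_I square
      L.quad_form L.Arf_quad involutions forms iso_iff_all not_iso_all equiv
    by (intro conjI)
qed

end
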